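(* Let $M$ be a finitely generated graded $S$-module with initially linear syzygies. Then $M$ is componentwise linear.
   Context: Let $k$ be a field, $S=k[x_1,\dots,x_n]$ with the standard grading, $\mathfrak m=(x_1,\dots,x_n)$. For a finitely generated graded $S$-module $M$, a presentation $0\to\ker\eta\to\bigoplus_{j=1}^r S\cdot g_j\xrightarrow{\eta}M\to0$ (free module with homogeneous basis $g_1,\dots,g_r$, $\eta$ degree-preserving) has initially linear syzygies with respect to a term order $\prec$ on $\bigoplus_j S\cdot g_j$ if $\ker\eta\subseteq\bigoplus_j\mathfrak m\cdot g_j$ and the initial module $\mathrm{in}_\prec(\ker\eta)$ is generated by terms of the form $x_ig_j$. $M$ has initially linear syzygies if it has such a presentation for some choice of generators and term order. For a graded module $M$ let $M_{\langle d\rangle}$ be the submodule generated by all homogeneous elements of degree $d$ in $M$. $M$ is componentwise linear if $M_{\langle d\rangle}$ has a linear resolution for all $d$ (i.e. the $i$-th module in its minimal graded free resolution is generated in degree $d+i$ for all $i$). *)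

theory Defs
  imports HOL.Modules "HOL-Library.Poly_Mapping"
begin

text \<open>
  The polynomial ring has one variable for each element of the finite type \<open>'x\<close>, so
  \<open>n = CARD('x)\<close>. A polynomial maps exponent vectors to coefficients.
\<close>

type_synonym 'x pp = "'x \<Rightarrow>\<^sub>0 nat"
type_synonym ('x, 'k) mpoly = "('x \<Rightarrow>\<^sub>0 nat) \<Rightarrow>\<^sub>0 'k"

definition Mon :: "'x pp \<Rightarrow> ('x, 'k::field) mpoly"
  where "Mon t = Poly_Mapping.single t 1"

definition Var :: "'x \<Rightarrow> ('x, 'k::field) mpoly"
  where "Var x = Mon (Poly_Mapping.single x 1)"

definition deg_pp :: "'x::finite pp \<Rightarrow> nat"
  where "deg_pp t = (\<Sum>x\<in>UNIV. Poly_Mapping.lookup t x)"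

text \<open>The graded pieces are indexed by integers; \<open>poly_graded e\<close> is zero for negative \<open>e\<close>.\<close>

definition poly_graded :: "int \<Rightarrow> ('x::finite, 'k::field) mpoly set"
  where "poly_graded e = {p. \<forall>t\<in>Poly_Mapping.keys p. int (deg_pp t) = e}"

definition max_ideal :: "('x::finite, 'k::field) mpoly set"
  where "max_ideal = module.span (*) (range Var)"

text \<open>
  The module is the whole type \<open>'m\<close>; submodules are subsets closed in the sense of
  \<open>subspace\<close>, and generation is \<open>span\<close>. The grading is by the integers.
\<close>

locale graded_module = module smult
  for smult :: "('x::finite, 'k::field) mpoly \<Rightarrow> 'm::ab_group_add \<Rightarrow> 'm" +
  fixes Mg :: "int \<Rightarrow> 'm set"
  assumes graded_zero: "0 \<in> Mg d"
    and graded_add: "\<lbrakk>v \<in> Mg d; w \<in> Mg d\<rbrakk> \<Longrightarrow> v + w \<in> Mg d"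
    and graded_smult: "\<lbrakk>p \<in> poly_graded e; v \<in> Mg d\<rbrakk> \<Longrightarrow> smult p v \<in> Mg (e + d)"
    and graded_direct_sum:
      "\<exists>!c :: int \<Rightarrow>\<^sub>0 'm. (\<forall>d. Poly_Mapping.lookup c d \<in> Mg d) \<and>
         v = (\<Sum>d\<in>Poly_Mapping.keys c. Poly_Mapping.lookup c d)"

definition finitely_generated ::
    "(('x::finite, 'k::field) mpoly \<Rightarrow> 'm::ab_group_add \<Rightarrow> 'm) \<Rightarrow> bool"
  where "finitely_generated smult \<longleftrightarrow> (\<exists>B. finite B \<and> module.span smult B = UNIV)"

definition graded_hom ::
    "(('x::finite, 'k::field) mpoly \<Rightarrow> 'a::ab_group_add \<Rightarrow> 'a) \<Rightarrow> (int \<Rightarrow> 'a set) \<Rightarrow>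
     (('x, 'k) mpoly \<Rightarrow> 'b::ab_group_add \<Rightarrow> 'b) \<Rightarrow> (int \<Rightarrow> 'b set) \<Rightarrow> ('a \<Rightarrow> 'b) \<Rightarrow> bool"
  where "graded_hom s1 A s2 B f \<longleftrightarrow> module_hom s1 s2 f \<and> (\<forall>e. f ` A e \<subseteq> B e)"

text \<open>
  All of them live in one type, the free module on countably many basis elements
  \<open>g\<^sub>0, g\<^sub>1, \<dots>\<close>; the free module of rank \<open>r\<close> is the submodule \<open>free_mod r\<close> on the basis
  elements \<open>g\<^sub>j\<close> with \<open>j < r\<close>. Every homomorphism defined on \<open>free_mod r\<close> extends to the whole
  type, so homomorphisms are taken on the type and only their restrictions matter.
\<close>

type_synonym ('x, 'k) fvec = "nat \<Rightarrow>\<^sub>0 (('x \<Rightarrow>\<^sub>0 nat) \<Rightarrow>\<^sub>0 'k)"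

definition fscale :: "('x, 'k::field) mpoly \<Rightarrow> ('x, 'k) fvec \<Rightarrow> ('x, 'k) fvec"
  where "fscale p v = Poly_Mapping.map ((*) p) v"

lemma lookup_fscale [simp]:
  "Poly_Mapping.lookup (fscale p v) j = p * Poly_Mapping.lookup v j"
  by (simp add: fscale_def Poly_Mapping.map.rep_eq when_def)

lemma module_fscale: "module fscale"
  by unfold_locales (auto intro!: poly_mapping_eqI simp: lookup_add algebra_simps)

lemma module_mpoly_times: "module ((*) :: ('x, 'k::field) mpoly \<Rightarrow> _)"
  by unfold_locales (auto simp: algebra_simps)

definition free_mod :: "nat \<Rightarrow> ('x, 'k::field) fvec set"
  where "free_mod r = {v. Poly_Mapping.keys v \<subseteq> {..<r}}"

text \<open>\<open>D j\<close> is the degree of the basis element \<open>g\<^sub>j\<close>.\<close>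

definition free_graded :: "nat \<Rightarrow> (nat \<Rightarrow> int) \<Rightarrow> int \<Rightarrow> ('x::finite, 'k::field) fvec set"
  where "free_graded r D e =
    {v \<in> free_mod r. \<forall>j<r. Poly_Mapping.lookup v j \<in> poly_graded (e - D j)}"

definition free_max :: "nat \<Rightarrow> ('x::finite, 'k::field) fvec set"
  where "free_max r = {v \<in> free_mod r. \<forall>j<r. Poly_Mapping.lookup v j \<in> max_ideal}"

text \<open>The pair \<open>(t, j)\<close> stands for the term \<open>x\<^sup>t g\<^sub>j\<close>; \<open>(a, b) \<in> ord\<close> means \<open>a \<preceq> b\<close>.\<close>

definition term_vec :: "'x pp \<times> nat \<Rightarrow> ('x, 'k::field) fvec"
  where "term_vec a = Poly_Mapping.single (snd a) (Mon (fst a))"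

definition terms :: "nat \<Rightarrow> ('x pp \<times> nat) set"
  where "terms r = UNIV \<times> {..<r}"

definition term_order :: "nat \<Rightarrow> (('x pp \<times> nat) \<times> ('x pp \<times> nat)) set \<Rightarrow> bool"
  where "term_order r ord \<longleftrightarrow> well_order_on (terms r) ord \<and>
    (\<forall>s i t j u. ((s, i), (t, j)) \<in> ord \<longrightarrow> ((u + s, i), (u + t, j)) \<in> ord)"

definition support :: "('x, 'k::field) fvec \<Rightarrow> ('x pp \<times> nat) set"
  where "support v = {(t, j). t \<in> Poly_Mapping.keys (Poly_Mapping.lookup v j)}"

text \<open>
  The initial term is taken without its coefficient; over a field this does not change the
  submodule that the initial terms generate. It is meaningful for nonzero vectors only.
\<close>

definition initial_term ::
    "(('x pp \<times> nat) \<times> ('x pp \<times> nat)) set \<Rightarrow> ('x, 'k::field) fvec \<Rightarrow> 'x pp \<times> nat"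
  where "initial_term ord v = (THE a. a \<in> support v \<and> (\<forall>b\<in>support v. (b, a) \<in> ord))"

definition initial_module ::
    "(('x pp \<times> nat) \<times> ('x pp \<times> nat)) set \<Rightarrow> ('x, 'k::field) fvec set \<Rightarrow> ('x, 'k) fvec set"
  where "initial_module ord K =
    module.span fscale {term_vec (initial_term ord v) | v. v \<in> K \<and> v \<noteq> 0}"

definition graded_presentation ::
    "(('x::finite, 'k::field) mpoly \<Rightarrow> 'm::ab_group_add \<Rightarrow> 'm) \<Rightarrow> (int \<Rightarrow> 'm set) \<Rightarrow>
     nat \<Rightarrow> (nat \<Rightarrow> int) \<Rightarrow> (('x, 'k) fvec \<Rightarrow> 'm) \<Rightarrow> bool"
  where "graded_presentation smult Mg r D \<eta> \<longleftrightarrow>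
    graded_hom fscale (free_graded r D) smult Mg \<eta> \<and> \<eta> ` free_mod r = UNIV"

definition free_kernel :: "nat \<Rightarrow> (('x, 'k::field) fvec \<Rightarrow> 'm::zero) \<Rightarrow> ('x, 'k) fvec set"
  where "free_kernel r f = {v \<in> free_mod r. f v = 0}"

definition presentation_initially_linear ::
    "nat \<Rightarrow> (('x::finite, 'k::field) fvec \<Rightarrow> 'm::zero) \<Rightarrow>
     (('x pp \<times> nat) \<times> ('x pp \<times> nat)) set \<Rightarrow> bool"
  where "presentation_initially_linear r \<eta> ord \<longleftrightarrow>
    free_kernel r \<eta> \<subseteq> free_max r \<and>
    (\<exists>A \<subseteq> {term_vec (Poly_Mapping.single x 1, j) | x j. j < r}.
       initial_module ord (free_kernel r \<eta>) = module.span fscale A)"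

definition initially_linear_syzygies ::
    "(('x::finite, 'k::field) mpoly \<Rightarrow> 'm::ab_group_add \<Rightarrow> 'm) \<Rightarrow> (int \<Rightarrow> 'm set) \<Rightarrow> bool"
  where "initially_linear_syzygies smult Mg \<longleftrightarrow>
    (\<exists>r D \<eta> ord. graded_presentation smult Mg r D \<eta> \<and> term_order r ord \<and>
       presentation_initially_linear r \<eta> ord)"

text \<open>
  A minimal graded free resolution
  \<open>\<dots> \<rightarrow> F\<^sub>2 \<rightarrow> F\<^sub>1 \<rightarrow> F\<^sub>0 \<rightarrow> N \<rightarrow> 0\<close> of a graded submodule \<open>N\<close>, where \<open>F\<^sub>i\<close> has rank \<open>r i\<close> and
  basis degrees \<open>D i\<close>; \<open>\<epsilon>\<close> is the augmentation and \<open>\<delta> i\<close> the differential from \<open>F\<^bsub>i+1\<^esub>\<close> to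
  \<open>F\<^sub>i\<close>. Minimality says that every differential maps into the maximal ideal times its target.
\<close>

definition minimal_graded_free_resolution ::
    "(('x::finite, 'k::field) mpoly \<Rightarrow> 'm::ab_group_add \<Rightarrow> 'm) \<Rightarrow> (int \<Rightarrow> 'm set) \<Rightarrow> 'm set \<Rightarrow>
     (nat \<Rightarrow> nat) \<Rightarrow> (nat \<Rightarrow> nat \<Rightarrow> int) \<Rightarrow>
     (('x, 'k) fvec \<Rightarrow> 'm) \<Rightarrow> (nat \<Rightarrow> ('x, 'k) fvec \<Rightarrow> ('x, 'k) fvec) \<Rightarrow> bool"
  where "minimal_graded_free_resolution smult Mg N r D \<epsilon> \<delta> \<longleftrightarrow>
    graded_hom fscale (free_graded (r 0) (D 0)) smult Mg \<epsilon> \<and>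
    (\<forall>i. graded_hom fscale (free_graded (r (Suc i)) (D (Suc i)))
                     fscale (free_graded (r i) (D i)) (\<delta> i)) \<and>
    \<epsilon> ` free_mod (r 0) = N \<and>
    \<delta> 0 ` free_mod (r 1) = free_kernel (r 0) \<epsilon> \<and>
    (\<forall>i. \<delta> (Suc i) ` free_mod (r (Suc (Suc i))) = free_kernel (r (Suc i)) (\<delta> i)) \<and>
    (\<forall>i. \<delta> i ` free_mod (r (Suc i)) \<subseteq> free_max (r i))"

text \<open>
  Minimal graded free resolutions are unique up to isomorphism, so that having one with the
  given basis degrees is a statement about \<^emph>\<open>the\<close> minimal resolution.
\<close>

definition has_linear_resolution ::
    "(('x::finite, 'k::field) mpoly \<Rightarrow> 'm::ab_group_add \<Rightarrow> 'm) \<Rightarrow> (int \<Rightarrow> 'm set) \<Rightarrow>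
     'm set \<Rightarrow> int \<Rightarrow> bool"
  where "has_linear_resolution smult Mg N d \<longleftrightarrow>
    (\<exists>r D \<epsilon> \<delta>. minimal_graded_free_resolution smult Mg N r D \<epsilon> \<delta> \<and>
       (\<forall>i. \<forall>j<r i. D i j = d + int i))"

definition degree_component ::
    "(('x::finite, 'k::field) mpoly \<Rightarrow> 'm::ab_group_add \<Rightarrow> 'm) \<Rightarrow> (int \<Rightarrow> 'm set) \<Rightarrow>
     int \<Rightarrow> 'm set"
  where "degree_component smult Mg d = module.span smult (Mg d)"

definition componentwise_linear ::
    "(('x::finite, 'k::field) mpoly \<Rightarrow> 'm::ab_group_add \<Rightarrow> 'm) \<Rightarrow> (int \<Rightarrow> 'm set) \<Rightarrow> bool"
  where "componentwise_linear smult Mg \<longleftrightarrow>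
    (\<forall>d. has_linear_resolution smult Mg (degree_component smult Mg d) d)"

end

theory Submission
  imports Defs "HOL-Library.Countable"
begin

text \<open>
  Let \<open>K\<close> be the kernel of the given presentation, and call a term \<open>x\<^sup>t g\<^sub>j\<close> standard if no variable
  \<open>x\<close> of \<open>x\<^sup>t\<close> has \<open>x g\<^sub>j\<close> in the initial module of \<open>K\<close>. The hypothesis says that the standard terms
  are linearly independent modulo \<open>K\<close> and that every other \<open>x g\<^sub>j\<close> is the leading term of an element
  of \<open>K\<close>; these two properties are the locale \<open>linear_presentation\<close>, and by division with remainder
  they imply that the standard terms span modulo \<open>K\<close>. The property is inherited in two ways.

  First (\<open>truncated_presentation\<close>), the submodule generated in degree \<open>d\<close> has a presentation of the
  same kind whose generators all have degree \<open>d\<close>: take the standard terms of degree \<open>d\<close>. Since \<open>K\<close>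
  lies in the maximal ideal times the free module, rewriting a term never leads to a basis element
  of larger degree, so that every standard term that occurs is a multiple of one of these
  generators. Multiples that give the same term are told apart by a numbering of the variables.

  Second (\<open>syzygy_presentation\<close>), \<open>K\<close> itself has a presentation of the same kind, with one
  generator of degree one more than \<open>g\<^sub>j\<close> for each leading term \<open>x g\<^sub>j\<close>. For fixed \<open>j\<close> these leading
  terms form, up to the factor \<open>g\<^sub>j\<close>, a set of variables, and the ideal generated by variables has
  linear quotients. Schreyer's argument lifts the resulting linear relations between leading terms
  to the relations between the elements of \<open>K\<close>.

  The first construction followed by infinitely many repetitions of the second yields a resolution
  of the submodule generated in degree \<open>d\<close> in which the \<open>i\<close>-th module is generated in degree \<open>d + i\<close>.
  It is minimal, because all relations lie in the maximal ideal times the free module.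
\<close>

(* As a destruction rule this makes classical search loop with in_keys_iff. *)
declare lookup_eq_zero_in_keys_contradict [rule del]

section \<open>Coefficients and terms of vectors\<close>

text \<open>The coefficient of the term \<open>x\<^sup>t g\<^sub>j\<close>, for \<open>a = (t, j)\<close>.\<close>

definition coef :: "('x, 'k::field) fvec \<Rightarrow> 'x pp \<times> nat \<Rightarrow> 'k"
  where "coef v a = Poly_Mapping.lookup (Poly_Mapping.lookup v (snd a)) (fst a)"

text \<open>The vector \<open>c x\<^sup>t g\<^sub>j\<close>, for \<open>a = (t, j)\<close>.\<close>

definition mterm :: "'x pp \<times> nat \<Rightarrow> 'k \<Rightarrow> ('x, 'k::field) fvec"
  where "mterm a c = Poly_Mapping.single (snd a) (Poly_Mapping.single (fst a) c)"

text \<open>The product of the monomial \<open>x\<^sup>u\<close> and a term.\<close>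

definition tmult :: "'x pp \<Rightarrow> 'x pp \<times> nat \<Rightarrow> 'x pp \<times> nat"
  where "tmult u a = (u + fst a, snd a)"

lemma fst_tmult [simp]: "fst (tmult u a) = u + fst a"
  and snd_tmult [simp]: "snd (tmult u a) = snd a"
  by (simp_all add: tmult_def)

lemma tmult_tmult: "tmult u (tmult v a) = tmult (u + v) a"
  by (simp add: tmult_def add.assoc)

lemma tmult_inject [simp]: "tmult u a = tmult u b \<longleftrightarrow> a = b"
  by (simp add: tmult_def prod_eq_iff)

lemma tmult_in_terms [simp]: "tmult u a \<in> terms r \<longleftrightarrow> a \<in> terms r"
  by (cases a) (simp add: tmult_def terms_def)

lemma in_terms_iff: "a \<in> terms r \<longleftrightarrow> snd a < r"
  by (cases a) (simp add: terms_def)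

lemma in_support_iff: "a \<in> support v \<longleftrightarrow> coef v a \<noteq> 0"
  by (cases a) (simp add: support_def coef_def in_keys_iff)

lemma coef_zero [simp]: "coef 0 a = 0"
  by (simp add: coef_def)

lemma coef_add [simp]: "coef (v + w) a = coef v a + coef w a"
  by (simp add: coef_def lookup_add)

lemma coef_diff [simp]: "coef (v - w) a = coef v a - coef w a"
  by (simp add: coef_def lookup_minus)

lemma coef_sum: "coef (sum f A) a = (\<Sum>i\<in>A. coef (f i) a)"
  by (simp add: coef_def lookup_sum)

lemma coef_mterm: "coef (mterm a c) b = (if b = a then c else 0)"
  by (auto simp: coef_def mterm_def lookup_single when_def prod_eq_iff)

lemma fvec_eqI: "(\<And>a. coef v a = coef w a) \<Longrightarrow> v = w"
  by (intro poly_mapping_eqI) (force simp: coef_def)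

lemma support_zero [simp]: "support 0 = {}"
  by (auto simp: in_support_iff)

lemma support_eq_empty_iff: "support v = {} \<longleftrightarrow> v = 0"
  by (metis coef_zero empty_iff fvec_eqI in_support_iff support_zero)

lemma support_add: "support (v + w) \<subseteq> support v \<union> support w"
  by (auto simp: in_support_iff)

lemma support_diff: "support (v - w) \<subseteq> support v \<union> support w"
  by (auto simp: in_support_iff)

lemma support_mterm: "support (mterm a c) \<subseteq> {a}"
  by (auto simp: in_support_iff coef_mterm split: if_splits)

lemma finite_support: "finite (support v)"
proof -
  have "support v = (\<Union>j\<in>Poly_Mapping.keys v.
      (\<lambda>t. (t, j)) ` Poly_Mapping.keys (Poly_Mapping.lookup v j))"
    (is "_ = ?A")
  proof (intro set_eqI iffI)
    fix a assume "a \<in> support v"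
    then have "snd a \<in> Poly_Mapping.keys v"
        "fst a \<in> Poly_Mapping.keys (Poly_Mapping.lookup v (snd a))"
      by (auto simp: in_support_iff coef_def in_keys_iff)
    then show "a \<in> ?A" by (intro UN_I[of "snd a"] image_eqI[of _ _ "fst a"]) simp_all
  qed (auto simp: support_def)
  then show ?thesis by simp
qed

lemma free_mod_iff: "v \<in> free_mod r \<longleftrightarrow> support v \<subseteq> terms r"
proof
  assume v: "support v \<subseteq> terms r"
  have "j < r" if j: "j \<in> Poly_Mapping.keys v" for j
  proof -
    have "Poly_Mapping.lookup v j \<noteq> 0"
      using j by (simp add: in_keys_iff)
    then obtain t where "Poly_Mapping.lookup (Poly_Mapping.lookup v j) t \<noteq> 0"
      by (metis poly_mapping_eqI lookup_zero)
    then have "(t, j) \<in> support v"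
      by (simp add: in_support_iff coef_def)
    then show ?thesis
      using v by (auto simp: in_terms_iff)
  qed
  then show "v \<in> free_mod r" by (auto simp: free_mod_def)
next
  assume v: "v \<in> free_mod r"
  show "support v \<subseteq> terms r"
  proof
    fix a assume "a \<in> support v"
    then have "Poly_Mapping.lookup v (snd a) \<noteq> 0"
      by (auto simp: in_support_iff coef_def)
    then show "a \<in> terms r"
      using v by (auto simp: free_mod_def in_terms_iff in_keys_iff)
  qed
qed

lemma mpoly_expand: "p = (\<Sum>t\<in>Poly_Mapping.keys p. Poly_Mapping.single t (Poly_Mapping.lookup p t))"
  by (rule poly_mapping_eqI) (simp add: lookup_sum lookup_single when_def in_keys_iff)

lemma lookup_single_mult_shift:
  fixes p :: "('x, 'k::field) mpoly"
  shows "Poly_Mapping.lookup (Poly_Mapping.single u c * p) (u + t) = c * Poly_Mapping.lookup p t"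
proof -
  have "Poly_Mapping.single u c * p =
      (\<Sum>s\<in>Poly_Mapping.keys p. Poly_Mapping.single (u + s) (c * Poly_Mapping.lookup p s))"
    by (subst mpoly_expand[of p]) (simp add: sum_distrib_left mult_single)
  then show ?thesis
    by (simp add: lookup_sum lookup_single when_def in_keys_iff)
qed

lemma coef_fscale_tmult [simp]:
  "coef (fscale (Poly_Mapping.single u c) v) (tmult u a) = c * coef v a"
  by (simp add: coef_def lookup_single_mult_shift)

lemma support_fscale: "support (fscale (Poly_Mapping.single u c) v) \<subseteq> tmult u ` support v"
proof
  fix a assume "a \<in> support (fscale (Poly_Mapping.single u c) v)"
  then have "fst a \<in> Poly_Mapping.keys (Poly_Mapping.single u c * Poly_Mapping.lookup v (snd a))"
    by (simp add: in_support_iff coef_def in_keys_iff)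
  then have "fst a \<in> {x + y | x y. x \<in> Poly_Mapping.keys (Poly_Mapping.single u c) \<and>
      y \<in> Poly_Mapping.keys (Poly_Mapping.lookup v (snd a))}"
    using keys_mult by fastforce
  then obtain t where t: "fst a = u + t" "t \<in> Poly_Mapping.keys (Poly_Mapping.lookup v (snd a))"
    by (auto split: if_splits)
  then have "(t, snd a) \<in> support v"
    by (simp add: support_def)
  then show "a \<in> tmult u ` support v"
    using t(1) by (metis fst_conv fst_tmult imageI prod_eqI snd_conv snd_tmult)
qed

lemma fscale_mterm:
  "fscale (Poly_Mapping.single u c) (mterm a d) = mterm (tmult u a) (c * d)"
  by (rule poly_mapping_eqI) (simp add: mterm_def lookup_single when_def mult_single)

lemma term_vec_eq_mterm: "term_vec a = mterm a 1"
  by (simp add: term_vec_def mterm_def Mon_def)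

lemma fvec_expand: "v = (\<Sum>a\<in>support v. mterm a (coef v a))"
  by (rule fvec_eqI) (simp add: coef_sum coef_mterm finite_support in_support_iff)

lemma fvec_induct [consumes 1, case_names zero add mterm]:
  assumes "support v \<subseteq> S" and "P 0" and "\<And>v w. P v \<Longrightarrow> P w \<Longrightarrow> P (v + w)"
    and "\<And>a c. a \<in> S \<Longrightarrow> P (mterm a c)"
  shows "P v"
proof -
  have "finite A \<Longrightarrow> A \<subseteq> S \<Longrightarrow> P (\<Sum>a\<in>A. mterm a (coef v a))" for A
    by (induction A rule: finite_induct) (use assms in auto)
  then show ?thesis
    using fvec_expand[of v] finite_support assms(1) by metis
qed


section \<open>Degrees\<close>

text \<open>The degree of the term \<open>x\<^sup>t g\<^sub>j\<close> when \<open>g\<^sub>j\<close> has degree \<open>D j\<close>.\<close>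

definition tdeg :: "(nat \<Rightarrow> int) \<Rightarrow> 'x::finite pp \<times> nat \<Rightarrow> int"
  where "tdeg D a = int (deg_pp (fst a)) + D (snd a)"

abbreviation xvar :: "'x \<Rightarrow> 'x pp"
  where "xvar x \<equiv> Poly_Mapping.single x 1"

lemma xvar_inject [simp]:
  "Poly_Mapping.single x (Suc 0) = Poly_Mapping.single y (Suc 0) \<longleftrightarrow> x = y"
  by (metis One_nat_def keys_single one_neq_zero singleton_inject)

lemma deg_pp_zero [simp]: "deg_pp 0 = 0"
  by (simp add: deg_pp_def)

lemma deg_pp_add [simp]: "deg_pp (s + t) = deg_pp s + deg_pp t"
  by (simp add: deg_pp_def lookup_add sum.distrib)

lemma deg_pp_single [simp]: "deg_pp (Poly_Mapping.single x n) = n"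
  by (simp add: deg_pp_def lookup_single when_def)

lemma deg_pp_eq_0_iff: "deg_pp t = 0 \<longleftrightarrow> t = 0"
  by (auto simp: deg_pp_def intro: poly_mapping_eqI)

lemma tdeg_tmult [simp]: "tdeg D (tmult u a) = int (deg_pp u) + tdeg D a"
  by (simp add: tdeg_def)

lemma in_keys_add_iff: "x \<in> Poly_Mapping.keys (s + t) \<longleftrightarrow>
    x \<in> Poly_Mapping.keys s \<or> x \<in> Poly_Mapping.keys t" for s t :: "'x pp"
  by (simp add: in_keys_iff lookup_add)

lemma pp_remove_var:
  fixes t :: "'x pp"
  assumes "x \<in> Poly_Mapping.keys t"
  obtains s where "t = s + xvar x"
proof
  show "t = (t - xvar x) + xvar x"
    using assms by (intro poly_mapping_eqI)
      (auto simp: lookup_add lookup_minus lookup_single when_def in_keys_iff)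
qed

lemma deg_pp_1E:
  assumes "deg_pp t = 1"
  obtains x where "t = xvar x"
proof -
  have "t \<noteq> 0" using assms by auto
  then obtain x where "x \<in> Poly_Mapping.keys t"
    by (metis equals0I keys_eq_empty)
  then obtain s where s: "t = s + xvar x" by (rule pp_remove_var)
  with assms have "s = 0" by (simp add: deg_pp_eq_0_iff)
  with s that show ?thesis by simp
qed

lemma finite_deg_pp: "finite {t :: 'x::finite pp. deg_pp t = n}"
proof -
  have "Poly_Mapping.lookup ` {t :: 'x pp. deg_pp t = n} \<subseteq>
      {f. \<forall>x. (x \<in> UNIV \<longrightarrow> f x \<in> {..n}) \<and> (x \<notin> UNIV \<longrightarrow> f x = 0)}"
    by (auto simp: deg_pp_def intro: member_le_sum)
  moreover have "finite {f. \<forall>x::'x. (x \<in> UNIV \<longrightarrow> f x \<in> {..n}) \<and> (x \<notin> UNIV \<longrightarrow> f x = 0)}"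
    by (rule finite_set_of_finite_funs) auto
  ultimately have "finite (Poly_Mapping.lookup ` {t :: 'x pp. deg_pp t = n})"
    by (rule finite_subset)
  then show ?thesis
    by (rule finite_imageD) (simp add: inj_on_def lookup_inject)
qed

lemma free_graded_iff:
  "v \<in> free_graded r D e \<longleftrightarrow> support v \<subseteq> {a \<in> terms r. tdeg D a = e}"
proof -
  have "(\<forall>j<r. Poly_Mapping.lookup v j \<in> poly_graded (e - D j)) \<longleftrightarrow>
      (\<forall>a\<in>support v. snd a < r \<longrightarrow> tdeg D a = e)"
    by (auto simp: poly_graded_def support_def tdeg_def eq_diff_eq)
  then show ?thesis
    unfolding free_graded_def free_mod_iff subset_iff mem_Collect_eq in_terms_iff by blast
qed

lemma max_ideal_iff: "p \<in> max_ideal \<longleftrightarrow> Poly_Mapping.lookup p 0 = 0"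
  for p :: "('x::finite, 'k::field) mpoly"
proof
  assume "p \<in> max_ideal"
  then show "Poly_Mapping.lookup p 0 = 0"
    unfolding max_ideal_def
  proof (induction rule: module.span_induct_alt[OF module_mpoly_times, consumes 1])
    case (2 c q p)
    then obtain x where q: "q = Var x" by auto
    have "0 \<notin> Poly_Mapping.keys (c * q)"
    proof
      assume "0 \<in> Poly_Mapping.keys (c * q)"
      then obtain s where "0 = s + xvar x"
        using keys_mult[of c q] by (auto simp: q Var_def Mon_def)
      then have "deg_pp (s + xvar x) = 0" by (metis deg_pp_zero)
      then show False by simp
    qed
    with 2 show ?case by (simp add: lookup_add in_keys_iff)
  qed simp
next
  interpret module "(*) :: ('x, 'k) mpoly \<Rightarrow> _" by (rule module_mpoly_times)
  assume p: "Poly_Mapping.lookup p 0 = 0"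
  have "Poly_Mapping.single t (Poly_Mapping.lookup p t) \<in> max_ideal"
    if t: "t \<in> Poly_Mapping.keys p" for t
  proof -
    have "t \<noteq> 0" using p t by (auto simp: in_keys_iff)
    then obtain x where "x \<in> Poly_Mapping.keys t"
      by (metis equals0I keys_eq_empty)
    then obtain s where s: "t = s + xvar x" by (rule pp_remove_var)
    have "Poly_Mapping.single t c = Poly_Mapping.single s c * (Var x :: ('x, 'k) mpoly)" for c
      by (simp add: s Var_def Mon_def mult_single)
    then show ?thesis
      unfolding max_ideal_def by (simp only: span_scale span_base rangeI)
  qed
  then show "p \<in> max_ideal"
    by (subst mpoly_expand) (auto simp: max_ideal_def intro: span_sum)
qed

lemma free_max_iff:
  "v \<in> free_max r \<longleftrightarrow> support v \<subseteq> {a \<in> terms r. fst a \<noteq> 0}"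
proof -
  have "(\<forall>j<r. Poly_Mapping.lookup v j \<in> max_ideal) \<longleftrightarrow>
      (\<forall>a\<in>support v. snd a < r \<longrightarrow> fst a \<noteq> 0)"
    by (auto simp: max_ideal_iff support_def in_keys_iff)
  then show ?thesis
    unfolding free_max_def free_mod_iff subset_iff mem_Collect_eq in_terms_iff by blast
qed

section \<open>Homomorphisms on free modules\<close>

text \<open>The homomorphism that sends each basis element \<open>g\<^sub>k\<close> to \<open>F k\<close>.\<close>

definition comb ::
    "(('x, 'k::field) mpoly \<Rightarrow> 'm::ab_group_add \<Rightarrow> 'm) \<Rightarrow> (nat \<Rightarrow> 'm) \<Rightarrow> ('x, 'k) fvec \<Rightarrow> 'm"
  where "comb smult F w = (\<Sum>k\<in>Poly_Mapping.keys w. smult (Poly_Mapping.lookup w k) (F k))"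

lemma module_hom_comb:
  assumes "module smult"
  shows "module_hom fscale smult (comb smult F)"
proof -
  interpret module smult by fact
  have comb: "comb smult F w = (\<Sum>k\<in>A. smult (Poly_Mapping.lookup w k) (F k))"
    if "finite A" "Poly_Mapping.keys w \<subseteq> A" for A w
    unfolding comb_def by (rule sum.mono_neutral_left) (use that in \<open>auto simp: in_keys_iff\<close>)
  have "comb smult F (v + w) = comb smult F v + comb smult F w" for v w
  proof -
    let ?A = "Poly_Mapping.keys v \<union> Poly_Mapping.keys w"
    show ?thesis
      using comb[of ?A v] comb[of ?A w] comb[of ?A "v + w"] keys_add[of v w]
      by (simp add: lookup_add scale_left_distrib sum.distrib)
  qed
  moreover have "comb smult F (fscale p w) = smult p (comb smult F w)" for p w
  proof -
    have "Poly_Mapping.keys (fscale p w) \<subseteq> Poly_Mapping.keys w"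
      by (auto simp: in_keys_iff)
    then show ?thesis
      using comb[of "Poly_Mapping.keys w" "fscale p w"] by (simp add: comb_def scale_sum_right)
  qed
  ultimately show ?thesis
    by (intro module_hom.intro module_fscale assms module_hom_axioms.intro)
qed

lemma comb_mterm:
  assumes "module smult"
  shows "comb smult F (mterm a c) = smult (Poly_Mapping.single (fst a) c) (F (snd a))"
proof -
  interpret module smult by fact
  show ?thesis by (simp add: comb_def mterm_def)
qed

section \<open>Leading terms\<close>

text \<open>A term order, given by its strict part.\<close>

definition strict_term_order :: "nat \<Rightarrow> ('x pp \<times> nat) rel \<Rightarrow> bool"
  where "strict_term_order r lt \<longleftrightarrow> wf lt \<and> trans lt \<and> total_on (terms r) lt \<and>
    (\<forall>a b u. (a, b) \<in> lt \<longrightarrow> (tmult u a, tmult u b) \<in> lt)"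

text \<open>
  The terms that may occur next to a leading term \<open>a\<close>: they are smaller and of the same degree,
  and the degree of their basis element is at most that of the basis element in \<open>a\<close>. The last
  condition holds for the elements of a minimal kernel, and it is what makes it possible to
  rewrite within the submodule that is generated in degrees up to a bound.
\<close>

definition below :: "(nat \<Rightarrow> int) \<Rightarrow> ('x::finite pp \<times> nat) rel \<Rightarrow> 'x pp \<times> nat \<Rightarrow> ('x pp \<times> nat) set"
  where "below D lt a = {b. (b, a) \<in> lt \<and> tdeg D b = tdeg D a \<and> D (snd b) \<le> D (snd a)}"

text \<open>The vector \<open>f\<close> is monic with leading term \<open>a\<close>, and its other terms are below \<open>a\<close>.\<close>

definition has_lead ::
    "(nat \<Rightarrow> int) \<Rightarrow> ('x::finite pp \<times> nat) rel \<Rightarrow> 'x pp \<times> nat \<Rightarrow> ('x, 'k::field) fvec \<Rightarrow> bool"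
  where "has_lead D lt a f \<longleftrightarrow> coef f a = 1 \<and> support f \<subseteq> insert a (below D lt a)"

lemma strict_term_order_irrefl: "strict_term_order r lt \<Longrightarrow> (a, a) \<notin> lt"
  by (auto simp: strict_term_order_def)

lemma strict_term_order_asym: "strict_term_order r lt \<Longrightarrow> (a, b) \<in> lt \<Longrightarrow> (b, a) \<notin> lt"
  by (auto simp: strict_term_order_def dest: wf_asym)

lemma strict_term_order_tmult: "strict_term_order r lt \<Longrightarrow> (a, b) \<in> lt \<Longrightarrow> (tmult u a, tmult u b) \<in> lt"
  unfolding strict_term_order_def by blast

lemma below_subset: "strict_term_order r lt \<Longrightarrow> b \<in> below D lt a \<Longrightarrow> below D lt b \<subseteq> below D lt a"
  by (auto simp: below_def strict_term_order_def dest: transD)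

lemma below_tmult:
  "strict_term_order r lt \<Longrightarrow> b \<in> below D lt a \<Longrightarrow> tmult u b \<in> below D lt (tmult u a)"
  by (simp add: below_def strict_term_order_tmult)

lemma finite_terms_max:
  assumes "strict_term_order r lt" and "finite X" "X \<noteq> {}" "X \<subseteq> terms r"
  shows "\<exists>m\<in>X. \<forall>b\<in>X. b \<noteq> m \<longrightarrow> (b, m) \<in> lt"
  using assms(2-)
proof (induction X rule: finite_ne_induct)
  case (insert x X)
  then obtain m where m: "m \<in> X" "\<And>b. b \<in> X \<Longrightarrow> b \<noteq> m \<Longrightarrow> (b, m) \<in> lt" by blast
  have "x \<noteq> m" using insert m by auto
  then consider "(x, m) \<in> lt" | "(m, x) \<in> lt"
    using assms(1) insert.prems m(1) by (auto simp: strict_term_order_def total_on_def)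
  then show ?case
  proof cases
    case 1
    with m show ?thesis by (intro bexI[of _ m]) auto
  next
    case 2
    have "(b, x) \<in> lt" if "b \<in> X" for b
      using that m(2)[of b] 2 assms(1) by (cases "b = m") (auto simp: strict_term_order_def dest: transD)
    then show ?thesis by (intro bexI[of _ x]) auto
  qed
qed simp

text \<open>
  A weight of monomials that is additive and tells variables apart, with variables numbered by
  \<open>to_nat\<close>. It serves to break ties.
\<close>

definition weight :: "'x::finite pp \<Rightarrow> nat"
  where "weight t = (\<Sum>x\<in>UNIV. to_nat x * Poly_Mapping.lookup t x)"

lemma weight_add: "weight (s + t) = weight s + weight t"
  by (simp add: weight_def lookup_add sum.distrib algebra_simps)

lemma weight_single [simp]: "weight (Poly_Mapping.single x n) = to_nat x * n"
  by (simp add: weight_def lookup_single when_def if_distrib[of "(*) _"] cong: if_cong)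

text \<open>
  A family \<open>F 0, \<dots>, F (r' - 1)\<close> of vectors in a free module of rank \<open>r\<close> with leading terms
  \<open>\<phi> 0, \<dots>, \<phi> (r' - 1)\<close> defines a homomorphism from the free module of rank \<open>r'\<close>. Assigning to
  the term \<open>x\<^sup>t e\<^sub>k\<close> the leading term \<open>lift (t, k)\<close> of its image pulls back the term order, as in
  Schreyer's construction.
\<close>

locale lead_family =
  fixes r :: nat and D :: "nat \<Rightarrow> int" and lt :: "('x::finite pp \<times> nat) rel"
    and r' :: nat and \<phi> :: "nat \<Rightarrow> 'x pp \<times> nat" and F :: "nat \<Rightarrow> ('x, 'k::field) fvec"
  assumes order: "strict_term_order r lt"
    and lead_in_terms: "k < r' \<Longrightarrow> \<phi> k \<in> terms r"
    and in_free_mod: "k < r' \<Longrightarrow> F k \<in> free_mod r"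
    and lead: "k < r' \<Longrightarrow> has_lead D lt (\<phi> k) (F k)"
begin

definition lift :: "'x pp \<times> nat \<Rightarrow> 'x pp \<times> nat"
  where "lift a = tmult (fst a) (\<phi> (snd a))"

text \<open>The basis degrees that make the homomorphism preserve degrees.\<close>

definition D' :: "nat \<Rightarrow> int"
  where "D' k = tdeg D (\<phi> k)"

text \<open>
  Terms with the same leading term are compared by the weight of the monomial in \<open>\<phi> k\<close>. The
  remaining ties are broken by the index, only to make the order total.
\<close>

definition lt' :: "('x pp \<times> nat) rel"
  where "lt' = inv_image (lt <*lex*> less_than <*lex*> less_than)
    (\<lambda>a. (lift a, weight (fst (\<phi> (snd a))), snd a))"

lemma lift_tmult: "lift (tmult u a) = tmult u (lift a)"
  by (simp add: lift_def tmult_tmult)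

lemma tdeg_lift: "tdeg D (lift a) = tdeg D' a"
  by (simp add: lift_def D'_def tdeg_def)

lemma lift_in_terms: "a \<in> terms r' \<Longrightarrow> lift a \<in> terms r"
  using lead_in_terms[of "snd a"] by (simp add: lift_def in_terms_iff)

lemma lift_less: "(lift b, lift a) \<in> lt \<Longrightarrow> (b, a) \<in> lt'"
  by (simp add: lt'_def)

lemma lift_less_tie:
  "lift b = lift a \<Longrightarrow> weight (fst (\<phi> (snd b))) < weight (fst (\<phi> (snd a))) \<Longrightarrow> (b, a) \<in> lt'"
  by (simp add: lt'_def)

lemma lifted_order: "strict_term_order r' lt'"
  unfolding strict_term_order_def
proof (intro conjI allI impI)
  show "wf lt'"
    using order unfolding lt'_def strict_term_order_def
    by (intro wf_inv_image wf_lex_prod wf_less_than) auto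
  show "trans lt'"
    using order unfolding lt'_def strict_term_order_def
    by (intro trans_inv_image trans_lex_prod trans_less_than) auto
  show "total_on (terms r') lt'"
  proof (rule total_onI)
    fix a b :: "'x pp \<times> nat"
    assume ab: "a \<in> terms r'" "b \<in> terms r'" "a \<noteq> b"
    show "(a, b) \<in> lt' \<or> (b, a) \<in> lt'"
    proof (cases "lift a = lift b")
      case True
      then have "snd a \<noteq> snd b"
        using ab(3) by (auto simp: lift_def tmult_def prod_eq_iff)
      then show ?thesis using True by (auto simp: lt'_def)
    next
      case False
      then show ?thesis
        using order lift_in_terms ab(1,2) lift_less
        unfolding strict_term_order_def total_on_def by blast
    qed
  qed
  show "(tmult u a, tmult u b) \<in> lt'" if "(a, b) \<in> lt'" for a b :: "'x pp \<times> nat" and u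
    using that strict_term_order_tmult[OF order, of "lift a" "lift b" u]
    by (auto simp: lt'_def lift_tmult)
qed

sublocale comb: module_hom fscale fscale "comb fscale F"
  by (rule module_hom_comb[OF module_fscale])

lemma coef_comb_mterm:
  assumes "a \<in> terms r'"
  shows "coef (comb fscale F (mterm a c)) (lift a) = c"
  using assms lead[of "snd a"]
  by (simp add: comb_mterm module_fscale lift_def has_lead_def in_terms_iff)

lemma support_comb_mterm:
  assumes "a \<in> terms r'"
  shows "support (comb fscale F (mterm a c)) \<subseteq> terms r \<inter> insert (lift a) (below D lt (lift a))"
proof
  fix b assume "b \<in> support (comb fscale F (mterm a c))"
  then obtain b' where b': "b' \<in> support (F (snd a))" "b = tmult (fst a) b'"
    using support_fscale by (fastforce simp: comb_mterm module_fscale)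
  have k: "snd a < r'" using assms by (simp add: in_terms_iff)
  have "b' \<in> insert (\<phi> (snd a)) (below D lt (\<phi> (snd a)))"
    using lead[OF k] b'(1) by (auto simp: has_lead_def)
  moreover have "b' \<in> terms r"
    using in_free_mod[OF k] b'(1) by (auto simp: free_mod_iff)
  ultimately show "b \<in> terms r \<inter> insert (lift a) (below D lt (lift a))"
    using below_tmult[OF order, of b' D "\<phi> (snd a)"] by (auto simp: b'(2) lift_def)
qed

lemma comb_free_graded: "comb fscale F ` free_graded r' D' e \<subseteq> free_graded r D e"
proof clarify
  fix w :: "('x, 'k) fvec"
  assume "w \<in> free_graded r' D' e"
  then have "support w \<subseteq> {a \<in> terms r'. tdeg D' a = e}" by (simp add: free_graded_iff)
  then show "comb fscale F w \<in> free_graded r D e"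
  proof (induction rule: fvec_induct)
    case (add v w)
    then show ?case using support_add by (fastforce simp: free_graded_iff comb.add)
  next
    case (mterm a c)
    then show ?case
      using support_comb_mterm[of a c] by (auto simp: free_graded_iff below_def tdeg_lift)
  qed (simp add: free_graded_iff)
qed

lemma comb_in_free_mod: "w \<in> free_mod r' \<Longrightarrow> comb fscale F w \<in> free_mod r"
proof -
  assume "w \<in> free_mod r'"
  then have "support w \<subseteq> terms r'" by (simp add: free_mod_iff)
  then show ?thesis
  proof (induction rule: fvec_induct)
    case (add v w)
    then show ?case using support_add by (fastforce simp: free_mod_iff comb.add)
  next
    case (mterm a c)
    then show ?case
      using support_comb_mterm[of a c] by (auto simp: free_mod_iff)
  qed (simp add: free_mod_iff)
qed

text \<open>Terms whose images have distinct leading terms are linearly independent.\<close>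

lemma comb_eq_0_imp:
  assumes w: "support w \<subseteq> terms r'" and inj: "inj_on lift (support w)"
    and 0: "comb fscale F w = 0"
  shows "w = 0"
proof (rule ccontr)
  assume "w \<noteq> 0"
  then have "lift ` support w \<noteq> {}" by (simp add: support_eq_empty_iff)
  moreover have "lift ` support w \<subseteq> terms r" using w lift_in_terms by auto
  ultimately obtain m where "m \<in> lift ` support w"
      and *: "\<And>b. b \<in> lift ` support w \<Longrightarrow> b \<noteq> m \<Longrightarrow> (b, m) \<in> lt"
    using finite_terms_max[OF order finite_imageI[OF finite_support]] by meson
  then obtain a where a: "a \<in> support w" "m = lift a" by auto
  have "coef (comb fscale F (mterm b (coef w b))) (lift a) = 0" if b: "b \<in> support w - {a}" for b
  proof (rule ccontr)
    assume "coef (comb fscale F (mterm b (coef w b))) (lift a) \<noteq> 0"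
    then have "lift a \<in> support (comb fscale F (mterm b (coef w b)))"
      by (simp add: in_support_iff)
    moreover have "b \<in> terms r'" using b w by auto
    ultimately have "lift a \<in> insert (lift b) (below D lt (lift b))"
      using support_comb_mterm[of b "coef w b"] by auto
    moreover have "lift a \<noteq> lift b" using inj a b by (auto simp: inj_on_def)
    ultimately have "(lift a, lift b) \<in> lt" by (auto simp: below_def)
    moreover have "(lift b, lift a) \<in> lt"
      using * a b \<open>lift a \<noteq> lift b\<close> by auto
    ultimately show False using strict_term_order_asym[OF order] by blast
  qed
  then have "(\<Sum>b\<in>support w. coef (comb fscale F (mterm b (coef w b))) (lift a)) =
      (\<Sum>b\<in>{a}. coef (comb fscale F (mterm b (coef w b))) (lift a))"
    by (intro sum.mono_neutral_right) (use a finite_support in auto)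
  also have "\<dots> = coef w a" using a(1) w by (simp add: coef_comb_mterm subsetD)
  also have "(\<Sum>b\<in>support w. coef (comb fscale F (mterm b (coef w b))) (lift a)) =
      coef (comb fscale F (\<Sum>b\<in>support w. mterm b (coef w b))) (lift a)"
    by (simp add: comb.sum coef_sum)
  also have "\<dots> = 0" using 0 fvec_expand[of w] by simp
  finally show False using a by (simp add: in_support_iff)
qed

end


section \<open>Presentations with initially linear syzygies\<close>

text \<open>
  The terms \<open>x\<^sup>t g\<^sub>j\<close> for which \<open>t\<close> involves only the variables in \<open>B j\<close>.
\<close>

definition standard :: "(nat \<Rightarrow> 'x set) \<Rightarrow> ('x pp \<times> nat) set"
  where "standard B = {a. Poly_Mapping.keys (fst a) \<subseteq> B (snd a)}"

text \<open>
  A homomorphism \<open>\<eta>\<close> on the free module of rank \<open>r\<close> whose kernel has the initial module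
  generated by the \<open>x g\<^sub>j\<close> with \<open>x \<notin> B j\<close>. This is expressed without initial modules: the
  standard terms are linearly independent modulo the kernel, and each such \<open>x g\<^sub>j\<close> is the leading
  term of an element of the kernel, which is homogeneous and has its other terms below \<open>x g\<^sub>j\<close>.
\<close>

locale linear_presentation = hom: module_hom fscale smult \<eta>
  for smult :: "('x::finite, 'k::field) mpoly \<Rightarrow> 'm::ab_group_add \<Rightarrow> 'm" and \<eta> +
  fixes r :: nat and D :: "nat \<Rightarrow> int" and lt :: "('x pp \<times> nat) rel" and B :: "nat \<Rightarrow> 'x set"
  assumes order: "strict_term_order r lt"
    and indep: "\<lbrakk>v \<in> free_mod r; support v \<subseteq> standard B; \<eta> v = 0\<rbrakk> \<Longrightarrow> v = 0"
    and rel: "\<lbrakk>j < r; x \<notin> B j\<rbrakk> \<Longrightarrow> \<exists>f\<in>free_kernel r \<eta>. has_lead D lt (xvar x, j) f"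

text \<open>A numbering of the elements of the kernel with leading terms \<open>x g\<^sub>j\<close>, \<open>x \<notin> B j\<close>.\<close>

locale linear_relations = linear_presentation smult \<eta> r D lt B
  for smult :: "('x::finite, 'k::field) mpoly \<Rightarrow> 'm::ab_group_add \<Rightarrow> 'm" and \<eta> r D lt B +
  fixes r' :: nat and \<phi> :: "nat \<Rightarrow> 'x pp \<times> nat" and F :: "nat \<Rightarrow> ('x, 'k) fvec"
  assumes bij: "bij_betw \<phi> {..<r'} {(xvar x, j) | x j. j < r \<and> x \<notin> B j}"
    and kernel: "k < r' \<Longrightarrow> F k \<in> free_kernel r \<eta>"
    and kernel_lead: "k < r' \<Longrightarrow> has_lead D lt (\<phi> k) (F k)"

lemma (in linear_presentation) ex_linear_relations:
  "\<exists>r' \<phi> F. linear_relations smult \<eta> r D lt B r' \<phi> F"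
proof -
  let ?P = "{(xvar x, j) | x j. j < r \<and> x \<notin> B j}"
  have "?P \<subseteq> (\<lambda>(x, j). (xvar x, j)) ` (UNIV \<times> {..<r})" by auto
  then have "finite ?P" by (rule finite_subset) simp
  then obtain \<phi> where \<phi>: "bij_betw \<phi> {..<card ?P} ?P"
    by (auto dest: ex_bij_betw_nat_finite simp: atLeast0LessThan)
  define F where "F k = (SOME f. f \<in> free_kernel r \<eta> \<and> has_lead D lt (\<phi> k) f)" for k
  have "F k \<in> free_kernel r \<eta> \<and> has_lead D lt (\<phi> k) (F k)" if "k < card ?P" for k
  proof -
    have "\<phi> k \<in> ?P" using bij_betwE[OF \<phi>] that by blast
    then obtain x j where xj: "\<phi> k = (xvar x, j)" "j < r" "x \<notin> B j" by blast
    have "\<exists>f. f \<in> free_kernel r \<eta> \<and> has_lead D lt (\<phi> k) f"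
      using rel[OF xj(2,3)] unfolding xj(1) by blast
    then show ?thesis unfolding F_def by (rule someI_ex)
  qed
  with \<phi> show ?thesis
    by (intro exI linear_relations.intro linear_presentation_axioms linear_relations_axioms.intro)
      auto
qed

context linear_relations
begin

lemma lead_cases:
  assumes "k < r'"
  obtains x j where "\<phi> k = (xvar x, j)" "j < r" "x \<notin> B j"
proof -
  have "\<phi> k \<in> {(xvar x, j) | x j. j < r \<and> x \<notin> B j}"
    using bij assms unfolding bij_betw_def by blast
  then show ?thesis using that by blast
qed

lemma lead_index:
  assumes "j < r" "x \<notin> B j"
  obtains k where "k < r'" "\<phi> k = (xvar x, j)"
proof -
  have "(xvar x, j) \<in> \<phi> ` {..<r'}"
    using bij assms unfolding bij_betw_def by blast
  then show ?thesis using that by force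
qed

sublocale lead_family r D lt r' \<phi> F
proof
  show "\<phi> k \<in> terms r" if "k < r'" for k
    using that by (rule lead_cases) (simp add: in_terms_iff)
qed (use order kernel kernel_lead in \<open>auto simp: free_kernel_def\<close>)

lemma D'_eq: "k < r' \<Longrightarrow> D' k = 1 + D (snd (\<phi> k))"
  by (erule lead_cases) (simp add: D'_def tdeg_def)

text \<open>
  Division by the relations: a vector is congruent modulo the kernel to a combination of standard
  terms, and the terms of the quotients and of the remainder stay in every set that is closed
  under passing to the terms below.
\<close>

lemma division:
  assumes closed: "\<And>a. a \<in> S \<Longrightarrow> below D lt a \<subseteq> S"
    and "support w \<subseteq> terms r \<inter> S"
  shows "\<exists>v q. w = v + comb fscale F q \<and> support v \<subseteq> terms r \<inter> S \<inter> standard B \<and>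
    support q \<subseteq> terms r' \<inter> lift -` S"
  (is "?P w")
proof -
  have wf: "wf lt" using order by (simp add: strict_term_order_def)
  have zero: "?P 0"
    by (intro exI[of _ 0]) (simp add: comb.zero)
  have add: "?P (v + w)" if v: "?P v" and w: "?P w" for v w
  proof -
    obtain v1 q1 v2 q2 where
      "v = v1 + comb fscale F q1" "support v1 \<subseteq> terms r \<inter> S \<inter> standard B"
      "support q1 \<subseteq> terms r' \<inter> lift -` S"
      "w = v2 + comb fscale F q2" "support v2 \<subseteq> terms r \<inter> S \<inter> standard B"
      "support q2 \<subseteq> terms r' \<inter> lift -` S"
      using v w by blast
    then show ?thesis
      using support_add[of v1 v2] support_add[of q1 q2]
      by (intro exI[of _ "v1 + v2", OF exI[of _ "q1 + q2"]]) (auto simp: comb.add)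
  qed
  have mterm: "a \<in> terms r \<inter> S \<Longrightarrow> ?P (mterm a c)" for a c
  proof (induction a arbitrary: c rule: wf_induct_rule[OF wf])
    case (1 a)
    show ?case
    proof (cases "a \<in> standard B")
      case True
      with "1.prems" show ?thesis
        using support_mterm[of a c] by (intro exI[of _ "mterm a c", OF exI[of _ 0]]) (auto simp: comb.zero)
    next
      case False
      then obtain x where x: "x \<in> Poly_Mapping.keys (fst a)" "x \<notin> B (snd a)"
        by (auto simp: standard_def)
      from x(1) obtain t where t: "fst a = t + xvar x" by (rule pp_remove_var)
      obtain k where k: "k < r'" "\<phi> k = (xvar x, snd a)"
        using lead_index[of "snd a" x] x(2) "1.prems" by (auto simp: in_terms_iff)
      have lift: "lift (t, k) = a"
        by (simp add: lift_def k t tmult_def prod_eq_iff)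
      have tk: "(t, k) \<in> terms r'" using k by (simp add: in_terms_iff)
      let ?q = "mterm (t, k) c"
      let ?w = "mterm a c - comb fscale F ?q"
      have "a \<notin> support ?w"
        using coef_comb_mterm[OF tk, of c] by (simp add: in_support_iff coef_mterm lift)
      then have "support ?w \<subseteq> terms r \<inter> below D lt a"
        using support_diff[of "mterm a c" "comb fscale F ?q"] support_mterm[of a c]
          support_comb_mterm[OF tk, of c] unfolding lift by blast
      then have "?P ?w"
      proof (induction rule: fvec_induct)
        case (mterm b d)
        then show ?case
          using "1.IH"[of b d] closed[of a] "1.prems" by (auto simp: below_def)
      qed (fact zero, fact add)
      moreover have "?P (comb fscale F ?q)"
        using tk "1.prems" support_mterm[of "(t, k)" c]
        by (intro exI[of _ 0, OF exI[of _ ?q]]) (auto simp: lift)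
      ultimately have "?P (?w + comb fscale F ?q)" by (rule add)
      then show ?thesis by simp
    qed
  qed
  show ?thesis
    using assms(2) by (rule fvec_induct) (fact zero, fact add, fact mterm)
qed

lemma comb_in_kernel: "q \<in> free_mod r' \<Longrightarrow> comb fscale F q \<in> free_kernel r \<eta>"
proof -
  assume q: "q \<in> free_mod r'"
  then have "support q \<subseteq> terms r'" by (simp add: free_mod_iff)
  then have "\<eta> (comb fscale F q) = 0"
  proof (induction rule: fvec_induct)
    case (mterm a c)
    then show ?case
      using kernel[of "snd a"]
      by (simp add: comb_mterm module_fscale in_terms_iff free_kernel_def hom.scale)
  qed (simp_all add: comb.zero comb.add hom.add)
  then show ?thesis using q comb_in_free_mod by (simp add: free_kernel_def)
qed

text \<open>Division leaves no remainder on the kernel.\<close>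

lemma kernel_division:
  assumes closed: "\<And>a. a \<in> S \<Longrightarrow> below D lt a \<subseteq> S"
    and w: "w \<in> free_kernel r \<eta>" "support w \<subseteq> S"
  shows "\<exists>q. w = comb fscale F q \<and> support q \<subseteq> terms r' \<inter> lift -` S"
proof -
  have "support w \<subseteq> terms r \<inter> S" using w by (auto simp: free_kernel_def free_mod_iff)
  then obtain v q where vq: "w = v + comb fscale F q" "support v \<subseteq> terms r \<inter> S \<inter> standard B"
      "support q \<subseteq> terms r' \<inter> lift -` S"
    using division[OF closed] by meson
  have "\<eta> (comb fscale F q) = 0"
    using comb_in_kernel[of q] vq(3) by (simp add: free_kernel_def free_mod_iff)
  then have "\<eta> v = 0"
    using w(1) vq(1) by (simp add: free_kernel_def hom.add)
  then have "v = 0"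
    using vq(2) by (intro indep) (auto simp: free_mod_iff)
  with vq show ?thesis by auto
qed

lemma comb_image: "comb fscale F ` free_mod r' = free_kernel r \<eta>"
proof (intro equalityI subsetI)
  fix w assume "w \<in> free_kernel r \<eta>"
  then show "w \<in> comb fscale F ` free_mod r'"
    using kernel_division[of UNIV w] by (auto simp: free_mod_iff)
qed (use comb_in_kernel in auto)

lemma kernel_subset_free_max: "free_kernel r \<eta> \<subseteq> free_max r"
proof -
  have "comb fscale F q \<in> free_max r" if "support q \<subseteq> terms r'" for q
    using that
  proof (induction rule: fvec_induct)
    case (add v w)
    then show ?case using support_add by (fastforce simp: free_max_iff comb.add)
  next
    case (mterm a c)
    have "snd a < r'" using mterm by (simp add: in_terms_iff)
    then obtain x j where "\<phi> (snd a) = (xvar x, j)" by (rule lead_cases)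
    then have "deg_pp (fst (lift a)) > 0" by (simp add: lift_def)
    then have "fst b \<noteq> 0" if "b \<in> insert (lift a) (below D lt (lift a))" for b
      using that by (auto simp: below_def tdeg_def)
    then show ?case
      using support_comb_mterm[OF mterm, of c] by (auto simp: free_max_iff)
  qed (simp add: free_max_iff comb.zero)
  then show ?thesis unfolding comb_image[symmetric] by (auto simp: free_mod_iff)
qed

end


section \<open>The syzygies of the kernel\<close>

context lead_family
begin

lemma below_liftI:
  "lift b \<in> below D lt (lift a) \<Longrightarrow> D' (snd b) \<le> D' (snd a) \<Longrightarrow> b \<in> below D' lt' a"
  by (simp add: below_def tdeg_lift lift_less)

lemma below_tieI:
  "lift b = lift a \<Longrightarrow> weight (fst (\<phi> (snd b))) < weight (fst (\<phi> (snd a))) \<Longrightarrow>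
    D' (snd b) \<le> D' (snd a) \<Longrightarrow> b \<in> below D' lt' a"
  using tdeg_lift[of a] tdeg_lift[of b] by (simp add: below_def lift_less_tie)

end

context linear_relations
begin

text \<open>
  Let \<open>e\<^sub>k\<close> correspond to the relation with leading term \<open>x g\<^sub>j\<close>. The variables that multiply
  \<open>e\<^sub>k\<close> to a standard term are those in \<open>B j\<close> and those with number at least that of \<open>x\<close>.
  Then a term \<open>x\<^sup>t g\<^sub>j\<close> that is not standard is the leading term of a unique standard multiple
  of a relation, the one for which \<open>x\<close> is the first variable of \<open>x\<^sup>t\<close> outside \<open>B j\<close>.
\<close>

definition B' :: "nat \<Rightarrow> 'x set"
  where "B' k = B (snd (\<phi> k)) \<union> {y. \<forall>x\<in>Poly_Mapping.keys (fst (\<phi> k)). to_nat x \<le> to_nat y}"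

lemma inj_on_lift: "inj_on lift (terms r' \<inter> standard B')"
proof (rule inj_onI)
  fix a b assume a: "a \<in> terms r' \<inter> standard B'" and b: "b \<in> terms r' \<inter> standard B'"
    and eq: "lift a = lift b"
  have "snd a < r'" "snd b < r'" using a b by (auto simp: in_terms_iff)
  obtain x i where x: "\<phi> (snd a) = (xvar x, i)" "x \<notin> B i"
    using \<open>snd a < r'\<close> by (rule lead_cases)
  obtain y j where y: "\<phi> (snd b) = (xvar y, j)" "y \<notin> B j"
    using \<open>snd b < r'\<close> by (rule lead_cases)
  have "i = j" and mon: "fst a + xvar x = fst b + xvar y"
    using eq by (auto simp: lift_def x y tmult_def)
  have "y \<in> Poly_Mapping.keys (fst a + xvar x)" "x \<in> Poly_Mapping.keys (fst b + xvar y)"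
    by (simp only: mon in_keys_add_iff, simp) (simp only: mon[symmetric] in_keys_add_iff, simp)
  then have "to_nat x \<le> to_nat y" "to_nat y \<le> to_nat x"
    using a b x y \<open>i = j\<close> unfolding in_keys_add_iff standard_def B'_def by force+
  then have "x = y" using injD[OF inj_to_nat] by auto
  with x y \<open>i = j\<close> have "\<phi> (snd a) = \<phi> (snd b)" by simp
  then have "snd a = snd b"
    using bij \<open>snd a < r'\<close> \<open>snd b < r'\<close> by (auto simp: bij_betw_def inj_on_def)
  moreover have "fst a = fst b" using mon \<open>x = y\<close> by simp
  ultimately show "a = b" by (rule prod_eqI[rotated])
qed

theorem syzygy_presentation: "linear_presentation fscale (comb fscale F) r' D' lt' B'"
proof
  show "strict_term_order r' lt'" by (rule lifted_order)
  show "v = 0" if "v \<in> free_mod r'" "support v \<subseteq> standard B'" "comb fscale F v = 0" for v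
  proof (rule comb_eq_0_imp)
    show "support v \<subseteq> terms r'" using that(1) by (simp add: free_mod_iff)
    with that(2) show "inj_on lift (support v)" by (intro inj_on_subset[OF inj_on_lift]) simp
  qed fact
next
  fix k y assume k: "k < r'" and y: "y \<notin> B' k"
  obtain x j where x: "\<phi> k = (xvar x, j)" "j < r" "x \<notin> B j" using k by (rule lead_cases)
  have y': "y \<notin> B j" "to_nat y < to_nat x"
    using y by (auto simp: B'_def x)
  obtain l where l: "l < r'" "\<phi> l = (xvar y, j)"
    using lead_index x(2) y'(1) by blast
  define a where "a = (xvar y, k)"
  define b where "b = (xvar x, l)"
  define S where "S = below D lt (lift a)"
  have ab: "a \<in> terms r'" "b \<in> terms r'" "a \<noteq> b"
    using k l y'(2) by (auto simp: a_def b_def in_terms_iff)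
  have lift: "lift b = lift a"
    by (simp add: a_def b_def lift_def x l tmult_def add.commute)
  let ?z = "mterm a 1 - mterm b 1"
  let ?w = "comb fscale F ?z"
  have "support ?z \<subseteq> terms r'"
    using support_diff[of "mterm a 1" "mterm b 1"] support_mterm[of a 1] support_mterm[of b 1] ab
    by auto
  then have z: "?z \<in> free_mod r'" by (simp add: free_mod_iff)
  \<comment> \<open>The two relations have the same leading coefficient, so that the leading terms cancel.\<close>
  have "lift a \<notin> support ?w"
    using coef_comb_mterm[OF ab(1), of 1] coef_comb_mterm[OF ab(2), of 1]
    by (simp add: in_support_iff comb.diff lift)
  then have "support ?w \<subseteq> S"
    using support_diff[of "comb fscale F (mterm a 1)" "comb fscale F (mterm b 1)"]
      support_comb_mterm[OF ab(1), of 1] support_comb_mterm[OF ab(2), of 1]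
    unfolding S_def lift comb.diff by blast
  then obtain q where q: "?w = comb fscale F q" "support q \<subseteq> terms r' \<inter> lift -` S"
    using kernel_division[of S ?w] comb_in_kernel[OF z] below_subset[OF order]
    unfolding S_def by blast
  have "a \<notin> support q"
    using q(2) strict_term_order_irrefl[OF order, of "lift a"] by (auto simp: S_def below_def)
  have "support (?z - q) \<subseteq> {a, b} \<union> support q"
    using support_diff[of ?z q] support_diff[of "mterm a 1" "mterm b 1"]
      support_mterm[of a 1] support_mterm[of b 1] by blast
  moreover have "b \<in> below D' lt' a"
    using lift y'(2) by (intro below_tieI) (auto simp: a_def b_def x l D'_def tdeg_def)
  moreover have "c \<in> below D' lt' a" if "c \<in> support q" for c
  proof (rule below_liftI)
    show "lift c \<in> below D lt (lift a)" using q(2) that by (auto simp: S_def)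
    moreover have "snd c < r'" using q(2) that by (auto simp: in_terms_iff)
    ultimately show "D' (snd c) \<le> D' (snd a)"
      using k by (simp add: D'_eq a_def below_def lift_def)
  qed
  ultimately have "support (?z - q) \<subseteq> insert a (below D' lt' a)" by blast
  moreover have "coef (?z - q) a = 1"
    using \<open>a \<notin> support q\<close> ab(3) by (simp add: coef_mterm in_support_iff)
  ultimately have "has_lead D' lt' a (?z - q)"
    by (simp add: has_lead_def)
  moreover have "?z - q \<in> free_kernel r' (comb fscale F)"
    using q support_diff[of ?z q] z by (auto simp: free_kernel_def free_mod_iff comb.diff)
  ultimately show "\<exists>f\<in>free_kernel r' (comb fscale F). has_lead D' lt' (xvar y, k) f"
    unfolding a_def by blast
qed

end


section \<open>Submodules generated in one degree\<close>

lemma (in linear_presentation) normal_form: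
  assumes "\<And>a. a \<in> S \<Longrightarrow> below D lt a \<subseteq> S" and "support w \<subseteq> terms r \<inter> S"
  shows "\<exists>v. support v \<subseteq> terms r \<inter> S \<inter> standard B \<and> \<eta> v = \<eta> w"
proof -
  obtain r' \<phi> F where "linear_relations smult \<eta> r D lt B r' \<phi> F"
    using ex_linear_relations by blast
  then interpret linear_relations smult \<eta> r D lt B r' \<phi> F .
  obtain v q where vq: "w = v + comb fscale F q" "support v \<subseteq> terms r \<inter> S \<inter> standard B"
      "support q \<subseteq> terms r' \<inter> lift -` S"
    using division[OF assms] by meson
  have "\<eta> (comb fscale F q) = 0"
    using comb_in_kernel[of q] vq(3) by (simp add: free_kernel_def free_mod_iff)
  with vq show ?thesis by (auto simp: hom.add)
qed

text \<open>
  A monomial of degree at least \<open>n\<close> has a unique factor \<open>x\<^sup>u\<close> of degree \<open>n\<close> that consists of its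
  first variables, in the order given by \<open>to_nat\<close>.
\<close>

lemma pp_split:
  fixes v :: "'x::finite pp"
  assumes "n \<le> deg_pp v"
  shows "\<exists>t u. v = t + u \<and> deg_pp u = n \<and>
    (\<forall>x\<in>Poly_Mapping.keys u. \<forall>y\<in>Poly_Mapping.keys t. to_nat x \<le> to_nat y)"
  using assms
proof (induction "deg_pp v - n" arbitrary: v)
  case 0
  then show ?case by (intro exI[of _ 0, OF exI[of _ v]]) auto
next
  case (Suc m)
  have "v \<noteq> 0" using Suc.hyps(2) by auto
  then have "to_nat ` Poly_Mapping.keys v \<noteq> {}" by simp
  then have "Max (to_nat ` Poly_Mapping.keys v) \<in> to_nat ` Poly_Mapping.keys v"
    by (intro Max_in) auto
  then obtain x where x: "x \<in> Poly_Mapping.keys v" "to_nat x = Max (to_nat ` Poly_Mapping.keys v)"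
    by auto
  have max: "to_nat y \<le> to_nat x" if "y \<in> Poly_Mapping.keys v" for y
    unfolding x(2) using that by simp
  obtain s where s: "v = s + xvar x" using x(1) by (rule pp_remove_var)
  have "m = deg_pp s - n" "n \<le> deg_pp s" using Suc.hyps(2) by (auto simp: s)
  then obtain t u where tu: "s = t + u" "deg_pp u = n"
      "\<forall>x\<in>Poly_Mapping.keys u. \<forall>y\<in>Poly_Mapping.keys t. to_nat x \<le> to_nat y"
    using Suc.hyps(1)[of s] by blast
  have "\<forall>z\<in>Poly_Mapping.keys u. to_nat z \<le> to_nat x"
    using max by (simp add: s tu in_keys_add_iff)
  with tu show ?case
    by (intro exI[of _ "t + xvar x", OF exI[of _ u]])
      (auto simp: s in_keys_add_iff add_ac)
qed

lemma pp_split_unique: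
  fixes t :: "'x::finite pp"
  assumes eq: "t + u = t' + u'" and deg: "deg_pp u = deg_pp u'"
    and tu: "\<And>x y. x \<in> Poly_Mapping.keys u \<Longrightarrow> y \<in> Poly_Mapping.keys t \<Longrightarrow> to_nat x \<le> to_nat y"
    and tu': "\<And>x y. x \<in> Poly_Mapping.keys u' \<Longrightarrow> y \<in> Poly_Mapping.keys t' \<Longrightarrow> to_nat x \<le> to_nat y"
  shows "u = u'"
proof (rule ccontr)
  assume ne: "u \<noteq> u'"
  have *: "\<exists>x. Poly_Mapping.lookup p x < Poly_Mapping.lookup q x"
    if "deg_pp p = deg_pp q" "p \<noteq> q" for p q :: "'x pp"
  proof (rule ccontr)
    assume "\<nexists>x. Poly_Mapping.lookup p x < Poly_Mapping.lookup q x"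
    then have le: "Poly_Mapping.lookup q x \<le> Poly_Mapping.lookup p x" for x by (simp add: not_less)
    have "p = (p - q) + q"
      by (rule poly_mapping_eqI) (simp add: lookup_add lookup_minus le)
    then have "deg_pp p = deg_pp (p - q) + deg_pp q" by (metis deg_pp_add)
    then have "p - q = 0" using that(1) by (simp add: deg_pp_eq_0_iff)
    with \<open>p = (p - q) + q\<close> that(2) show False by simp
  qed
  obtain x where x: "Poly_Mapping.lookup u x < Poly_Mapping.lookup u' x"
    using *[of u u'] deg ne by auto
  obtain y where y: "Poly_Mapping.lookup u' y < Poly_Mapping.lookup u y"
    using *[of u' u] deg ne by auto
  have sum: "Poly_Mapping.lookup t z + Poly_Mapping.lookup u z =
      Poly_Mapping.lookup t' z + Poly_Mapping.lookup u' z" for z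
    using eq by (metis lookup_add)
  have "x \<in> Poly_Mapping.keys t" "x \<in> Poly_Mapping.keys u'"
    using x sum[of x] by (auto simp: in_keys_iff)
  moreover have "y \<in> Poly_Mapping.keys t'" "y \<in> Poly_Mapping.keys u"
    using y sum[of y] by (auto simp: in_keys_iff)
  ultimately have "to_nat x = to_nat y" using tu[of y x] tu'[of x y] by simp
  then have "x = y" using injD[OF inj_to_nat] by auto
  with x y show False by simp
qed

text \<open>
  The generators \<open>x\<^sup>u g\<^sub>j\<close> of the submodule generated in degree \<open>d\<close>, where \<open>(u, j)\<close> runs through
  the standard terms of degree \<open>d\<close>.
\<close>

locale truncation = linear_presentation smult \<eta> r D lt B
  for smult :: "('x::finite, 'k::field) mpoly \<Rightarrow> 'm::ab_group_add \<Rightarrow> 'm" and \<eta> r D lt B +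
  fixes d :: int and r' :: nat and \<phi> :: "nat \<Rightarrow> 'x pp \<times> nat"
  assumes bij: "bij_betw \<phi> {..<r'} {a \<in> terms r \<inter> standard B. tdeg D a = d}"

lemma (in linear_presentation) ex_truncation: "\<exists>r' \<phi>. truncation smult \<eta> r D lt B d r' \<phi>"
proof -
  let ?P = "{a \<in> terms r \<inter> standard B. tdeg D a = d}"
  have "?P \<subseteq> (\<Union>j<r. {u. deg_pp u = nat (d - D j)} \<times> {j})"
    by (auto simp: terms_def tdeg_def)
  then have "finite ?P" by (rule finite_subset) (auto intro: finite_deg_pp)
  then obtain \<phi> where "bij_betw \<phi> {..<card ?P} ?P"
    by (auto dest: ex_bij_betw_nat_finite simp: atLeast0LessThan)
  then show ?thesis
    by (intro exI truncation.intro linear_presentation_axioms truncation_axioms.intro)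
qed

context truncation
begin

lemma index: "k < r' \<Longrightarrow> \<phi> k \<in> terms r \<inter> standard B \<and> tdeg D (\<phi> k) = d"
  using bij_betwE[OF bij] by auto

sublocale lead_family r D lt r' \<phi> "\<lambda>k. mterm (\<phi> k) (1::'k)"
proof
  show "mterm (\<phi> k) 1 \<in> free_mod r" if "k < r'" for k
    using index[OF that] support_mterm by (fastforce simp: free_mod_iff)
  show "has_lead D lt (\<phi> k) (mterm (\<phi> k) 1)" if "k < r'" for k
    using support_mterm by (fastforce simp: has_lead_def coef_mterm)
qed (use order index in auto)

abbreviation \<psi> :: "('x, 'k) fvec \<Rightarrow> ('x, 'k) fvec"
  where "\<psi> \<equiv> comb fscale (\<lambda>k. mterm (\<phi> k) 1)"

lemma \<psi>_mterm: "\<psi> (mterm a c) = mterm (lift a) c"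
  by (simp add: comb_mterm module_fscale fscale_mterm lift_def)

lemma D'_eq: "k < r' \<Longrightarrow> D' k = d"
  using index by (simp add: D'_def)

text \<open>
  A standard monomial of degree at least \<open>d\<close> is written as a multiple of a generator \<open>x\<^sup>u g\<^sub>j\<close>
  by putting its first variables into \<open>u\<close>. The variables that multiply the generator to a
  standard term are therefore those of \<open>B j\<close> that do not precede a variable of \<open>u\<close>.
\<close>

definition B' :: "nat \<Rightarrow> 'x set"
  where "B' k = B (snd (\<phi> k)) \<inter> {y. \<forall>x\<in>Poly_Mapping.keys (fst (\<phi> k)). to_nat x \<le> to_nat y}"

lemma lift_standard: "a \<in> terms r' \<Longrightarrow> a \<in> standard B' \<Longrightarrow> lift a \<in> standard B"
  using index[of "snd a"]
  by (auto simp: in_terms_iff standard_def B'_def lift_def in_keys_add_iff)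

lemma inj_on_lift: "inj_on lift (terms r' \<inter> standard B')"
proof (rule inj_onI)
  fix a b assume a: "a \<in> terms r' \<inter> standard B'" and b: "b \<in> terms r' \<inter> standard B'"
    and eq: "lift a = lift b"
  have ab: "snd a < r'" "snd b < r'" using a b by (auto simp: in_terms_iff)
  have snd: "snd (\<phi> (snd a)) = snd (\<phi> (snd b))"
    and mon: "fst a + fst (\<phi> (snd a)) = fst b + fst (\<phi> (snd b))"
    using eq by (auto simp: lift_def tmult_def)
  have "fst (\<phi> (snd a)) = fst (\<phi> (snd b))"
  proof (rule pp_split_unique[OF mon])
    show "deg_pp (fst (\<phi> (snd a))) = deg_pp (fst (\<phi> (snd b)))"
      using index[OF ab(1)] index[OF ab(2)] snd by (simp add: tdeg_def)
  qed (use a b in \<open>auto simp: standard_def B'_def\<close>)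
  with snd have "\<phi> (snd a) = \<phi> (snd b)" by (simp add: prod_eq_iff)
  then have "snd a = snd b"
    using bij ab by (auto simp: bij_betw_def inj_on_def)
  moreover have "fst a = fst b" using mon \<open>\<phi> (snd a) = \<phi> (snd b)\<close> by simp
  ultimately show "a = b" by (rule prod_eqI[rotated])
qed

lemma ex_lift:
  assumes a: "a \<in> terms r" "a \<in> standard B" and d: "D (snd a) \<le> d" "d \<le> tdeg D a"
  obtains b where "b \<in> terms r'" "b \<in> standard B'" "lift b = a"
proof -
  have "nat (d - D (snd a)) \<le> deg_pp (fst a)" using d by (simp add: tdeg_def)
  then obtain t u where tu: "fst a = t + u" "deg_pp u = nat (d - D (snd a))"
      "\<forall>x\<in>Poly_Mapping.keys u. \<forall>y\<in>Poly_Mapping.keys t. to_nat x \<le> to_nat y"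
    using pp_split by blast
  have "(u, snd a) \<in> {a \<in> terms r \<inter> standard B. tdeg D a = d}"
    using a d(1) by (auto simp: in_terms_iff standard_def tu in_keys_add_iff tdeg_def)
  then obtain k where k: "k < r'" "\<phi> k = (u, snd a)"
    using bij_betw_imp_surj_on[OF bij] by (metis (no_types, lifting) imageE lessThan_iff)
  show ?thesis
  proof (rule that)
    show "(t, k) \<in> terms r'" using k by (simp add: in_terms_iff)
    show "(t, k) \<in> standard B'"
      using a(2) tu(1,3) by (auto simp: standard_def B'_def k in_keys_add_iff)
    show "lift (t, k) = a" by (simp add: lift_def k prod_eq_iff tu)
  qed
qed

lemma ex_preimage:
  assumes "support v \<subseteq> terms r \<inter> S \<inter> standard B"
    and S: "\<And>a. a \<in> S \<Longrightarrow> D (snd a) \<le> d \<and> d \<le> tdeg D a"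
  shows "\<exists>q. \<psi> q = v \<and> support q \<subseteq> terms r' \<inter> lift -` S"
  using assms(1)
proof (induction rule: fvec_induct)
  case zero
  show ?case by (intro exI[of _ 0]) (simp add: comb.zero)
next
  case (add v w)
  then obtain p q where "\<psi> p = v" "support p \<subseteq> terms r' \<inter> lift -` S"
      "\<psi> q = w" "support q \<subseteq> terms r' \<inter> lift -` S" by blast
  then show ?case
    using support_add[of p q] by (intro exI[of _ "p + q"]) (auto simp: comb.add)
next
  case (mterm a c)
  then obtain b where "b \<in> terms r'" "lift b = a" using ex_lift[of a] S[of a] by blast
  with mterm show ?case
    using support_mterm[of b c] by (intro exI[of _ "mterm b c"]) (auto simp: \<psi>_mterm)
qed

text \<open>
  If the variable \<open>y\<close> does not multiply \<open>e\<^sub>k\<close> to a standard term, then modulo the kernel \<open>y e\<^sub>k\<close> is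
  a combination of smaller terms.
\<close>

lemma ex_lower_preimage:
  assumes k: "k < r'" and y: "y \<notin> B' k"
  shows "\<exists>q. support q \<subseteq> terms r' \<inter> below D' lt' (xvar y, k) \<and>
    \<eta> (\<psi> q) = \<eta> (mterm (lift (xvar y, k)) 1)"
proof -
  define a where "a = (xvar y, k)"
  define u where "u = fst (\<phi> k)"
  define j where "j = snd (\<phi> k)"
  have \<phi>k: "\<phi> k = (u, j)" by (simp add: u_def j_def)
  have j: "j < r" "D j \<le> d" and u: "int (deg_pp u) + D j = d"
    using index[OF k] by (auto simp: \<phi>k in_terms_iff tdeg_def)
  have lift_a: "lift a = (xvar y + u, j)" by (simp add: lift_def a_def \<phi>k tmult_def)
  have "\<exists>q. support q \<subseteq> terms r' \<inter> below D' lt' a \<and> \<eta> (\<psi> q) = \<eta> (mterm (lift a) 1)"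
  proof (cases "y \<in> B j")
    case True
    \<comment> \<open>The image of \<open>y e\<^sub>k\<close> is a standard term. It is also the image of a standard multiple of
      another generator, which precedes \<open>e\<^sub>k\<close> in the tie-break.\<close>
    then have "lift a \<in> standard B" "lift a \<in> terms r"
      using index[OF k] j(1)
      by (auto simp: standard_def lift_a \<phi>k in_keys_add_iff in_terms_iff)
    then obtain b where b: "b \<in> terms r'" "b \<in> standard B'" "lift b = lift a"
      using ex_lift[of "lift a"] j(2) u by (auto simp: lift_a tdeg_def)
    define l where "l = snd b"
    have l: "l < r'" using b(1) by (simp add: in_terms_iff l_def)
    have lj: "snd (\<phi> l) = j" and mon: "fst b + fst (\<phi> l) = xvar y + u"
      using b(3) unfolding lift_a by (auto simp: lift_def tmult_def l_def)
    have "deg_pp (fst (\<phi> l)) = deg_pp u"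
      using index[OF l] u lj by (auto simp: tdeg_def)
    then have "deg_pp (fst b) = 1"
      using arg_cong[OF mon, of deg_pp] by simp
    then obtain z where z: "fst b = xvar z" by (rule deg_pp_1E)
    obtain x where x: "x \<in> Poly_Mapping.keys u" "to_nat y < to_nat x"
      using y True by (auto simp: B'_def \<phi>k not_le)
    have "x \<in> Poly_Mapping.keys (xvar z + fst (\<phi> l))"
      using x(1) by (simp only: mon[unfolded z] in_keys_add_iff) simp
    moreover have "to_nat x' \<le> to_nat z" if "x' \<in> Poly_Mapping.keys (fst (\<phi> l))" for x'
      using b(2) that by (auto simp: standard_def z B'_def l_def)
    ultimately have "to_nat x \<le> to_nat z" by (auto simp: in_keys_add_iff)
    then have "weight (fst (\<phi> l)) < weight u"
      using x(2) arg_cong[OF mon, of weight] by (simp add: z weight_add)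
    then have "b \<in> below D' lt' a"
      using b(3) l k by (intro below_tieI) (auto simp: l_def[symmetric] a_def D'_eq u_def)
    with b show ?thesis
      using support_mterm[of b 1] by (intro exI[of _ "mterm b 1"]) (auto simp: \<psi>_mterm)
  next
    case False
    then obtain f where f: "f \<in> free_kernel r \<eta>" "has_lead D lt (xvar y, j) f"
      using rel j(1) by blast
    let ?S = "below D lt (lift a)"
    let ?g = "fscale (Poly_Mapping.single u 1) f"
    let ?w = "mterm (lift a) 1 - ?g"
    have lift_a': "lift a = tmult u (xvar y, j)" by (simp add: lift_a tmult_def add.commute)
    have "lift a \<notin> support ?w"
      using f(2) by (simp add: in_support_iff coef_mterm lift_a' has_lead_def)
    moreover have "support ?g \<subseteq> insert (lift a) ?S"
      using support_fscale[of u 1 f] f(2) below_tmult[OF order, of _ D "(xvar y, j)" u]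
      unfolding lift_a' has_lead_def by blast
    moreover have "support ?g \<subseteq> terms r"
      using support_fscale[of u 1 f] f(1) by (force simp: free_kernel_def free_mod_iff)
    moreover have "lift a \<in> terms r" using j(1) by (simp add: lift_a in_terms_iff)
    ultimately have "support ?w \<subseteq> terms r \<inter> ?S"
      using support_diff[of "mterm (lift a) 1" ?g] support_mterm[of "lift a" 1] by blast
    then obtain v where v: "support v \<subseteq> terms r \<inter> ?S \<inter> standard B" "\<eta> v = \<eta> ?w"
      using normal_form[of ?S ?w] below_subset[OF order] by blast
    have "D (snd b) \<le> d \<and> d \<le> tdeg D b" if "b \<in> ?S" for b
      using that j(2) u by (auto simp: below_def lift_a tdeg_def)
    then obtain q where q: "\<psi> q = v" "support q \<subseteq> terms r' \<inter> lift -` ?S"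
      using ex_preimage[OF v(1)] by blast
    have "b \<in> below D' lt' a" if "b \<in> support q" for b
    proof (rule below_liftI)
      have "snd b < r'" using q(2) that by (auto simp: in_terms_iff)
      then show "D' (snd b) \<le> D' (snd a)" using k by (simp add: a_def D'_eq)
    qed (use q(2) that in blast)
    moreover have "\<eta> ?w = \<eta> (mterm (lift a) 1)"
      using f(1) by (simp add: hom.diff hom.scale free_kernel_def)
    ultimately show ?thesis using q v(2) by auto
  qed
  then show ?thesis by (simp add: a_def)
qed

theorem truncated_presentation: "linear_presentation smult (\<eta> \<circ> \<psi>) r' D' lt' B'"
proof -
  interpret comp: module_hom fscale smult "\<eta> \<circ> \<psi>"
    by (rule module_hom_compose[OF comb.module_hom_axioms hom.module_hom_axioms])
  show ?thesis
  proof
    show "strict_term_order r' lt'" by (rule lifted_order)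
    show "v = 0" if v: "v \<in> free_mod r'" "support v \<subseteq> standard B'" "(\<eta> \<circ> \<psi>) v = 0" for v
    proof (rule comb_eq_0_imp)
      show r': "support v \<subseteq> terms r'" using v(1) by (simp add: free_mod_iff)
      with v(2) show "inj_on lift (support v)" by (intro inj_on_subset[OF inj_on_lift]) simp
      have "support v \<subseteq> terms r' \<inter> standard B'" using r' v(2) by simp
      then have "support (\<psi> v) \<subseteq> terms r \<inter> standard B"
      proof (induction rule: fvec_induct)
        case (add v w)
        then show ?case using support_add[of "\<psi> v" "\<psi> w"] by (auto simp: comb.add)
      next
        case (mterm a c)
        then show ?case
          using support_mterm[of "lift a" c] lift_standard[of a] lift_in_terms[of a]
          by (auto simp: \<psi>_mterm)
      qed (simp add: comb.zero)
      then show "\<psi> v = 0"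
        using v(3) by (intro indep) (auto simp: free_mod_iff)
    qed
  next
    fix k y assume k: "k < r'" and y: "y \<notin> B' k"
    define a where "a = (xvar y, k)"
    obtain q where q: "support q \<subseteq> terms r' \<inter> below D' lt' a" "\<eta> (\<psi> q) = \<eta> (mterm (lift a) 1)"
      using ex_lower_preimage[OF k y] unfolding a_def by blast
    let ?f = "mterm a 1 - q"
    have a: "a \<in> terms r'" using k by (simp add: a_def in_terms_iff)
    have supp: "support ?f \<subseteq> insert a (support q)"
      using support_diff[of "mterm a 1" q] support_mterm[of a 1] by blast
    have "a \<notin> support q"
      using q(1) strict_term_order_irrefl[OF lifted_order, of a] by (auto simp: below_def)
    then have "has_lead D' lt' a ?f"
      using supp q(1) by (auto simp: has_lead_def coef_mterm in_support_iff)
    moreover have "?f \<in> free_kernel r' (\<eta> \<circ> \<psi>)"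
      using supp a q
      by (auto simp: free_kernel_def free_mod_iff comb.diff hom.diff \<psi>_mterm)
    ultimately show "\<exists>f\<in>free_kernel r' (\<eta> \<circ> \<psi>). has_lead D' lt' (xvar y, k) f"
      unfolding a_def by blast
  qed
qed

end


section \<open>Homogeneous components\<close>

text \<open>The component of degree \<open>d\<close> of a vector.\<close>

definition hcomp :: "(nat \<Rightarrow> int) \<Rightarrow> int \<Rightarrow> ('x::finite, 'k::field) fvec \<Rightarrow> ('x, 'k) fvec"
  where "hcomp D d w = (\<Sum>a\<in>{a \<in> support w. tdeg D a = d}. mterm a (coef w a))"

lemma coef_hcomp: "coef (hcomp D d w) a = (if tdeg D a = d then coef w a else 0)"
proof -
  have "finite {a \<in> support w. tdeg D a = d}" by (simp add: finite_support)
  then have "coef (hcomp D d w) a = (if a \<in> {a \<in> support w. tdeg D a = d} then coef w a else 0)"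
    by (simp add: hcomp_def coef_sum coef_mterm)
  then show ?thesis by (simp add: in_support_iff)
qed

lemma support_hcomp: "support (hcomp D d w) = {a \<in> support w. tdeg D a = d}"
  by (auto simp: in_support_iff coef_hcomp split: if_splits)

lemma hcomp_free_graded: "w \<in> free_mod r \<Longrightarrow> hcomp D d w \<in> free_graded r D d"
  by (auto simp: free_graded_iff support_hcomp free_mod_iff)

lemma hcomp_expand: "w = (\<Sum>e\<in>tdeg D ` support w. hcomp D e w)"
  by (rule fvec_eqI) (auto simp: coef_sum coef_hcomp finite_support in_support_iff)

text \<open>
  If the image of a vector under a graded homomorphism is homogeneous, it is already the image of
  the component of that degree.
\<close>

lemma (in graded_module) graded_hom_hcomp:
  assumes \<eta>: "graded_hom fscale (free_graded r D) smult Mg \<eta>"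
    and w: "w \<in> free_mod r" "\<eta> w \<in> Mg d"
  shows "\<eta> (hcomp D d w) = \<eta> w"
proof -
  interpret h: module_hom fscale smult \<eta> using \<eta> by (simp add: graded_hom_def)
  define E where "E = tdeg D ` support w"
  have E: "finite E" by (simp add: E_def finite_support)
  define c where "c = (\<Sum>e\<in>E. Poly_Mapping.single e (\<eta> (hcomp D e w)))"
  define c' where "c' = Poly_Mapping.single d (\<eta> w)"
  have zero: "hcomp D e w = 0" if "e \<notin> E" for e
    using that by (intro fvec_eqI) (auto simp: coef_hcomp E_def in_support_iff)
  have c: "Poly_Mapping.lookup c e = \<eta> (hcomp D e w)" for e
    using E by (auto simp: c_def lookup_sum lookup_single when_def zero)
  have "\<eta> w = (\<Sum>e\<in>E. Poly_Mapping.lookup c e)"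
    by (subst hcomp_expand[of w D]) (simp add: E_def c h.sum)
  also have "\<dots> = (\<Sum>e\<in>Poly_Mapping.keys c. Poly_Mapping.lookup c e)"
  proof (rule sum.mono_neutral_right[OF E])
    show "Poly_Mapping.keys c \<subseteq> E"
    proof
      fix e assume "e \<in> Poly_Mapping.keys c"
      then show "e \<in> E" using zero[of e] by (cases "e \<in> E") (auto simp: in_keys_iff c)
    qed
  qed (auto simp: in_keys_iff)
  finally have "\<eta> w = (\<Sum>e\<in>Poly_Mapping.keys c. Poly_Mapping.lookup c e)" .
  moreover have "Poly_Mapping.lookup c e \<in> Mg e" for e
    using \<eta> hcomp_free_graded[OF w(1), of D e] unfolding c graded_hom_def by blast
  moreover have "\<eta> w = (\<Sum>e\<in>Poly_Mapping.keys c'. Poly_Mapping.lookup c' e)"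
    by (simp add: c'_def)
  moreover have "Poly_Mapping.lookup c' e \<in> Mg e" for e
    using w(2) graded_zero by (auto simp: c'_def lookup_single when_def)
  ultimately have "c = c'" using graded_direct_sum[of "\<eta> w"] by blast
  then show ?thesis using c[of d] by (simp add: c'_def)
qed

section \<open>From initial modules to leading terms\<close>

lemma term_order_strict:
  assumes "term_order r ord"
  shows "strict_term_order r (ord - Id)"
proof -
  have wo: "wf (ord - Id)" "trans ord" "antisym ord" "total_on (terms r) ord"
    using assms by (auto simp: term_order_def well_order_on_def linear_order_on_def
      partial_order_on_def preorder_on_def)
  have "(tmult u a, tmult u b) \<in> ord" if "(a, b) \<in> ord" for a b u
    using assms that unfolding term_order_def tmult_def by (metis prod.collapse)
  then show ?thesis
    using wo by (simp add: strict_term_order_def trans_diff_Id)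
qed

lemma initial_term:
  assumes "term_order r ord" and v: "v \<in> free_mod r" "v \<noteq> 0"
  shows "initial_term ord v \<in> support v"
    and "b \<in> support v \<Longrightarrow> b \<noteq> initial_term ord v \<Longrightarrow> (b, initial_term ord v) \<in> ord - Id"
proof -
  have "support v \<noteq> {}" "support v \<subseteq> terms r"
    using v by (auto simp: support_eq_empty_iff free_mod_iff)
  then obtain m where m: "m \<in> support v" "\<And>b. b \<in> support v \<Longrightarrow> b \<noteq> m \<Longrightarrow> (b, m) \<in> ord - Id"
    using finite_terms_max[OF term_order_strict[OF assms(1)] finite_support] by blast
  have refl: "(m, m) \<in> ord"
    using assms(1) m(1) \<open>support v \<subseteq> terms r\<close>
    by (auto simp: term_order_def well_order_on_def linear_order_on_def
      partial_order_on_def preorder_on_def refl_on_def)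
  have "antisym ord"
    using assms(1) by (auto simp: term_order_def well_order_on_def linear_order_on_def
      partial_order_on_def)
  have "initial_term ord v = m"
    unfolding initial_term_def
  proof (rule the_equality)
    show "m \<in> support v \<and> (\<forall>b\<in>support v. (b, m) \<in> ord)"
      using m refl by blast
    show "a = m" if "a \<in> support v \<and> (\<forall>b\<in>support v. (b, a) \<in> ord)" for a
      using that m \<open>antisym ord\<close> by (metis DiffD1 antisymD)
  qed
  with m show "initial_term ord v \<in> support v"
    and "b \<in> support v \<Longrightarrow> b \<noteq> initial_term ord v \<Longrightarrow> (b, initial_term ord v) \<in> ord - Id"
    by auto
qed

lemma support_span_terms:
  assumes "v \<in> module.span fscale (term_vec ` X)" "a \<in> support v"
  shows "\<exists>b\<in>X. \<exists>u. a = tmult u b"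
proof -
  have "\<forall>a\<in>support v. \<exists>b\<in>X. \<exists>u. a = tmult u b"
    using assms(1)
  proof (induction rule: module.span_induct_alt[OF module_fscale, consumes 1])
    case (2 p x v)
    then obtain b where b: "b \<in> X" "x = term_vec b" by auto
    have "\<exists>u. a = tmult u b" if "a \<in> support (fscale p x)" for a
    proof -
      have "snd a = snd b" and "fst a \<in> Poly_Mapping.keys (p * Mon (fst b))"
        using that by (auto simp: in_support_iff coef_def b term_vec_def in_keys_iff
          lookup_single when_def split: if_splits)
      then obtain u where "fst a = u + fst b"
        using keys_mult[of p "Mon (fst b)"] by (auto simp: Mon_def)
      with \<open>snd a = snd b\<close> show ?thesis by (auto simp: tmult_def prod_eq_iff)
    qed
    with 2 b(1) show ?case using support_add[of "fscale p x" v] by blast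
  qed simp
  with assms(2) show ?thesis by blast
qed

lemma initially_linear_imp_linear_presentation:
  fixes smult :: "('x::finite, 'k::field) mpoly \<Rightarrow> 'm::ab_group_add \<Rightarrow> 'm"
  assumes "graded_module smult Mg" and pres: "graded_presentation smult Mg r D \<eta>"
    and ord: "term_order r ord" and lin: "presentation_initially_linear r \<eta> ord"
  shows "\<exists>B. linear_presentation smult \<eta> r D (ord - Id) B"
proof -
  interpret graded_module smult Mg by fact
  have gh: "graded_hom fscale (free_graded r D) smult Mg \<eta>"
    using pres by (simp add: graded_presentation_def)
  interpret f: module "fscale :: ('x, 'k) mpoly \<Rightarrow> _" by (rule module_fscale)
  interpret h: module_hom fscale smult \<eta> using gh by (simp add: graded_hom_def)
  let ?K = "free_kernel r \<eta>"
  obtain A where "A \<subseteq> {term_vec (xvar x, j) | x j. j < r}"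
      and init: "initial_module ord ?K = f.span A" and max: "?K \<subseteq> free_max r"
    using lin by (auto simp: presentation_initially_linear_def)
  define B where "B j = {x. term_vec (xvar x, j) \<notin> A}" for j
  define X where "X = {(xvar x, j) | x j. term_vec (xvar x, j) \<in> A}"
  have A: "A = term_vec ` X"
    using \<open>A \<subseteq> _\<close> by (auto simp: X_def)
  have "linear_presentation smult \<eta> r D (ord - Id) B"
  proof
    show "strict_term_order r (ord - Id)" by (rule term_order_strict) fact
    show "v = 0" if v: "v \<in> free_mod r" "support v \<subseteq> standard B" "\<eta> v = 0" for v
    proof (rule ccontr)
      assume "v \<noteq> 0"
      let ?a = "initial_term ord v"
      have "?a \<in> support v" using initial_term(1)[OF ord v(1) \<open>v \<noteq> 0\<close>] .
      have "term_vec ?a \<in> initial_module ord ?K"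
        unfolding initial_module_def using v \<open>v \<noteq> 0\<close>
        by (intro f.span_base) (auto simp: free_kernel_def)
      moreover have "?a \<in> support (term_vec ?a :: ('x, 'k) fvec)"
        by (simp add: term_vec_eq_mterm in_support_iff coef_mterm)
      ultimately obtain b u where "b \<in> X" "?a = tmult u b"
        unfolding init A using support_span_terms by blast
      then obtain x j where "?a = tmult u (xvar x, j)" "x \<notin> B j"
        by (auto simp: X_def B_def)
      moreover have "x \<in> Poly_Mapping.keys (u + xvar x)" by (simp add: in_keys_add_iff)
      ultimately have "?a \<notin> standard B"
        by (auto simp: standard_def tmult_def)
      then show False using \<open>?a \<in> support v\<close> v(2) by blast
    qed
  next
    fix j x assume "j < r" "x \<notin> B j"
    then have "term_vec (xvar x, j) \<in> initial_module ord ?K"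
      unfolding init by (intro f.span_base) (simp add: B_def)
    moreover have "{term_vec (initial_term ord v) | v. v \<in> ?K \<and> v \<noteq> 0} =
        (term_vec ` (initial_term ord ` (?K - {0})) :: ('x, 'k) fvec set)" by auto
    ultimately have span: "term_vec (xvar x, j) \<in> f.span (term_vec ` (initial_term ord ` (?K - {0})))"
      by (simp only: initial_module_def)
    have "(xvar x, j) \<in> support (term_vec (xvar x, j) :: ('x, 'k) fvec)"
      by (simp add: term_vec_eq_mterm in_support_iff coef_mterm)
    from support_span_terms[OF span this]
    have "\<exists>b\<in>initial_term ord ` (?K - {0}). \<exists>u. (xvar x, j) = tmult u b" .
    then obtain v u where v: "v \<in> ?K" "v \<noteq> 0" and "(xvar x, j) = tmult u (initial_term ord v)"
      by blast
    then obtain t where t: "initial_term ord v = (t, j)" "xvar x = u + t"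
      by (cases "initial_term ord v") (auto simp: tmult_def)
    have vr: "v \<in> free_mod r" using v by (simp add: free_kernel_def)
    note it = initial_term[OF ord vr v(2)]
    have "t \<noteq> 0" using it(1) max v(1) by (force simp: t free_max_iff)
    moreover have "deg_pp u + deg_pp t = 1" using arg_cong[OF t(2), of deg_pp] by simp
    ultimately have "deg_pp u = 0" using deg_pp_eq_0_iff[of t] by linarith
    then have "u = 0" by (simp add: deg_pp_eq_0_iff)
    define a where "a = (xvar x, j)"
    have a: "initial_term ord v = a" using t \<open>u = 0\<close> by (simp add: a_def)
    define c where "c = inverse (coef v a)"
    have "coef v a \<noteq> 0" using it(1) by (simp add: a in_support_iff)
    \<comment> \<open>The homogeneous component that contains the initial term, made monic.\<close>
    define f where "f = fscale (Poly_Mapping.single 0 c) (hcomp D (tdeg D a) v)"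
    have coef_f: "coef f b = (if tdeg D b = tdeg D a then c * coef v b else 0)" for b
      using coef_fscale_tmult[of 0 c "hcomp D (tdeg D a) v" b]
      by (simp add: f_def tmult_def coef_hcomp)
    have "b \<in> insert a (below D (ord - Id) a)" if b: "b \<in> support f" for b
    proof (cases "b = a")
      case False
      have bv: "b \<in> support v" and deg: "tdeg D b = tdeg D a"
        using b by (auto simp: in_support_iff coef_f split: if_splits)
      have "(b, a) \<in> ord - Id" using it(2)[OF bv] False by (simp add: a)
      moreover have "fst b \<noteq> 0" using bv subsetD[OF max v(1)] by (auto simp: free_max_iff)
      then have "deg_pp (fst b) \<ge> 1" using deg_pp_eq_0_iff[of "fst b"] by linarith
      then have "D (snd b) \<le> D (snd a)" using deg by (simp add: tdeg_def a_def)
      ultimately show ?thesis using deg by (simp add: below_def)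
    qed simp
    then have "has_lead D (ord - Id) a f"
      using \<open>coef v a \<noteq> 0\<close> by (auto simp: has_lead_def coef_f c_def)
    moreover have "\<eta> v \<in> Mg (tdeg D a)" using v(1) graded_zero by (simp add: free_kernel_def)
    then have "\<eta> f = 0"
      using graded_hom_hcomp[OF gh vr] v(1) by (simp add: f_def h.scale free_kernel_def)
    moreover have "support f \<subseteq> support v"
      by (auto simp: in_support_iff coef_f split: if_splits)
    ultimately show "\<exists>f\<in>?K. has_lead D (ord - Id) (xvar x, j) f"
      unfolding a_def using vr by (auto simp: free_kernel_def free_mod_iff)
  qed
  then show ?thesis by blast
qed


section \<open>The linear resolution\<close>

lemma (in linear_presentation) ex_syzygy_presentation:
  "\<exists>r' D' \<delta> lt' B'. linear_presentation fscale \<delta> r' D' lt' B' \<and>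
    (\<forall>c. (\<forall>j<r. D j = c) \<longrightarrow> (\<forall>k<r'. D' k = c + 1)) \<and>
    \<delta> ` free_mod r' = free_kernel r \<eta> \<and> free_kernel r \<eta> \<subseteq> free_max r \<and>
    (\<forall>e. \<delta> ` free_graded r' D' e \<subseteq> free_graded r D e)"
proof -
  obtain r' \<phi> F where "linear_relations smult \<eta> r D lt B r' \<phi> F"
    using ex_linear_relations by blast
  then interpret linear_relations smult \<eta> r D lt B r' \<phi> F .
  have "D' k = c + 1" if "\<forall>j<r. D j = c" "k < r'" for c k
    using that D'_eq[of k] lead_in_terms[of k] by (simp add: in_terms_iff)
  then show ?thesis
    using syzygy_presentation comb_image kernel_subset_free_max comb_free_graded by blast
qed

theorem linear_presentation_imp_linear_resolution:
  fixes smult :: "('x::finite, 'k::field) mpoly \<Rightarrow> 'm::ab_group_add \<Rightarrow> 'm"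
  assumes pres: "linear_presentation smult \<epsilon> r\<^sub>0 D\<^sub>0 lt\<^sub>0 B\<^sub>0"
    and gh: "graded_hom fscale (free_graded r\<^sub>0 D\<^sub>0) smult Mg \<epsilon>"
    and D\<^sub>0: "\<forall>j<r\<^sub>0. D\<^sub>0 j = d"
  shows "has_linear_resolution smult Mg (\<epsilon> ` free_mod r\<^sub>0) d"
proof -
  \<comment> \<open>A stage is a rank, the basis degrees, the differential, a term order and the sets of
    variables; \<open>next_stage\<close> presents the kernel of a homomorphism by the next free module.\<close>
  define good :: "nat \<Rightarrow> nat \<times> (nat \<Rightarrow> int) \<times> (('x, 'k) fvec \<Rightarrow> ('x, 'k) fvec) \<times>
      ('x pp \<times> nat) rel \<times> (nat \<Rightarrow> 'x set) \<Rightarrow> bool"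
    where "good i = (\<lambda>(r, D, \<delta>, lt, B). linear_presentation fscale \<delta> r D lt B \<and>
      (\<forall>j<r. D j = d + int (Suc i)))" for i
  define next_stage :: "nat \<times> (nat \<Rightarrow> int) \<times> (('x, 'k) fvec \<Rightarrow> ('x, 'k) fvec) \<times>
      ('x pp \<times> nat) rel \<times> (nat \<Rightarrow> 'x set) \<Rightarrow> nat \<times> (nat \<Rightarrow> int) \<times>
      (('x, 'k) fvec \<Rightarrow> ('x, 'k) fvec) \<times> ('x pp \<times> nat) rel \<times> (nat \<Rightarrow> 'x set) \<Rightarrow> bool"
    where "next_stage = (\<lambda>(r, D, \<eta>, lt, B) (r', D', \<delta>, lt', B').
      \<delta> ` free_mod r' = free_kernel r \<eta> \<and> free_kernel r \<eta> \<subseteq> free_max r \<and>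
      (\<forall>e. \<delta> ` free_graded r' D' e \<subseteq> free_graded r D e))"
  obtain r\<^sub>1 D\<^sub>1 \<delta>\<^sub>1 lt\<^sub>1 B\<^sub>1 where one: "linear_presentation fscale \<delta>\<^sub>1 r\<^sub>1 D\<^sub>1 lt\<^sub>1 B\<^sub>1"
      "\<forall>j<r\<^sub>1. D\<^sub>1 j = d + 1" "\<delta>\<^sub>1 ` free_mod r\<^sub>1 = free_kernel r\<^sub>0 \<epsilon>"
      "free_kernel r\<^sub>0 \<epsilon> \<subseteq> free_max r\<^sub>0"
      "\<forall>e. \<delta>\<^sub>1 ` free_graded r\<^sub>1 D\<^sub>1 e \<subseteq> free_graded r\<^sub>0 D\<^sub>0 e"
    using linear_presentation.ex_syzygy_presentation[OF pres] D\<^sub>0 by metis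
  have ex: "\<exists>s'. good (Suc i) s' \<and> next_stage s s'" if "good i s" for i s
  proof -
    obtain r D \<eta> lt B where s: "s = (r, D, \<eta>, lt, B)" by (cases s)
    then have "linear_presentation fscale \<eta> r D lt B" and D: "\<forall>j<r. D j = d + int (Suc i)"
      using that by (auto simp: good_def)
    from linear_presentation.ex_syzygy_presentation[OF this(1)]
    obtain r' D' \<delta> lt' B' where *: "linear_presentation fscale \<delta> r' D' lt' B'"
      "\<forall>c. (\<forall>j<r. D j = c) \<longrightarrow> (\<forall>k<r'. D' k = c + 1)"
      "\<delta> ` free_mod r' = free_kernel r \<eta>" "free_kernel r \<eta> \<subseteq> free_max r"
      "\<forall>e. \<delta> ` free_graded r' D' e \<subseteq> free_graded r D e"
      by (elim exE conjE) (rule that)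
    have "\<forall>k<r'. D' k = d + int (Suc (Suc i))"
      using *(2) D by (auto simp: algebra_simps)
    with * show ?thesis
      by (intro exI[of _ "(r', D', \<delta>, lt', B')"]) (simp add: good_def next_stage_def s)
  qed
  define g where "g i s = (SOME s'. good (Suc i) s' \<and> next_stage s s')" for i s
  have g: "good (Suc i) (g i s) \<and> next_stage s (g i s)" if "good i s" for i s
    unfolding g_def by (rule someI_ex) (rule ex[OF that])
  define f where "f = rec_nat (r\<^sub>1, D\<^sub>1, \<delta>\<^sub>1, lt\<^sub>1, B\<^sub>1) g"
  have f0: "f 0 = (r\<^sub>1, D\<^sub>1, \<delta>\<^sub>1, lt\<^sub>1, B\<^sub>1)" and f_Suc: "f (Suc i) = g i (f i)" for i
    by (simp_all add: f_def)
  have good: "good i (f i)" for i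
  proof (induction i)
    case 0
    show ?case using one(1,2) by (simp add: f0 good_def)
  next
    case (Suc i)
    then show ?case using g by (simp add: f_Suc)
  qed
  have nxt: "next_stage (f i) (f (Suc i))" for i
    using g[OF good] by (simp add: f_Suc)
  define r where "r i = (case i of 0 \<Rightarrow> r\<^sub>0 | Suc m \<Rightarrow> fst (f m))" for i
  define D where "D i = (case i of 0 \<Rightarrow> D\<^sub>0 | Suc m \<Rightarrow> fst (snd (f m)))" for i
  define \<delta> where "\<delta> i = fst (snd (snd (f i)))" for i
  have lin: "linear_presentation fscale (\<delta> i) (r (Suc i)) (D (Suc i))
      (fst (snd (snd (snd (f i))))) (snd (snd (snd (snd (f i)))))"
    and degs: "\<forall>j<r (Suc i). D (Suc i) j = d + int (Suc i)" for i
    using good[of i] by (auto simp: good_def r_def D_def \<delta>_def split: prod.splits)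
  have step: "\<delta> (Suc i) ` free_mod (r (Suc (Suc i))) = free_kernel (r (Suc i)) (\<delta> i)"
    "free_kernel (r (Suc i)) (\<delta> i) \<subseteq> free_max (r (Suc i))"
    "\<forall>e. \<delta> (Suc i) ` free_graded (r (Suc (Suc i))) (D (Suc (Suc i))) e \<subseteq>
      free_graded (r (Suc i)) (D (Suc i)) e" for i
    using nxt[of i] by (auto simp: next_stage_def r_def D_def \<delta>_def split: prod.splits)
  have zero: "r 0 = r\<^sub>0" "D 0 = D\<^sub>0" "r (Suc 0) = r\<^sub>1" "D (Suc 0) = D\<^sub>1" "\<delta> 0 = \<delta>\<^sub>1"
    by (simp_all add: r_def D_def \<delta>_def f0)
  have hom: "module_hom fscale fscale (\<delta> i)" for i
    using lin[of i] by (simp add: linear_presentation_def)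
  have graded: "\<forall>e. \<delta> i ` free_graded (r (Suc i)) (D (Suc i)) e \<subseteq> free_graded (r i) (D i) e" for i
    using one(5) step(3) by (cases i) (simp_all add: zero)
  have min: "\<delta> i ` free_mod (r (Suc i)) \<subseteq> free_max (r i)" for i
    using one(3,4) step(1,2) by (cases i) (simp_all add: zero)
  have "minimal_graded_free_resolution smult Mg (\<epsilon> ` free_mod r\<^sub>0) r D \<epsilon> \<delta>"
    unfolding minimal_graded_free_resolution_def
    using gh hom graded min one(3) step(1) by (simp add: zero graded_hom_def)
  moreover have "\<forall>i. \<forall>j<r i. D i j = d + int i"
  proof
    show "\<forall>j<r i. D i j = d + int i" for i
      using D\<^sub>0 degs by (cases i) (simp_all add: zero)
  qed
  ultimately show ?thesis unfolding has_linear_resolution_def by blast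
qed

lemma (in truncation) image_eq_degree_component:
  assumes "graded_module smult Mg" and pres: "graded_presentation smult Mg r D \<eta>"
  shows "(\<eta> \<circ> \<psi>) ` free_mod r' = degree_component smult Mg d"
proof -
  interpret graded_module smult Mg by fact
  interpret comp: module_hom fscale smult "\<eta> \<circ> \<psi>"
    by (rule module_hom_compose[OF comb.module_hom_axioms hom.module_hom_axioms])
  have gh: "graded_hom fscale (free_graded r D) smult Mg \<eta>" and surj: "\<eta> ` free_mod r = UNIV"
    using pres by (simp_all add: graded_presentation_def)
  show ?thesis
  proof
    have "\<eta> (\<psi> q) \<in> hom.m2.span (Mg d)" if "support q \<subseteq> terms r'" for q
      using that
    proof (induction rule: fvec_induct)
      case (mterm a c)
      have "snd a < r'" using mterm by (simp add: in_terms_iff)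
      then have "mterm (\<phi> (snd a)) 1 \<in> free_graded r D d"
        using index[of "snd a"] support_mterm[of "\<phi> (snd a)" 1] by (auto simp: free_graded_iff)
      then have "\<eta> (mterm (\<phi> (snd a)) 1) \<in> Mg d"
        using gh by (auto simp: graded_hom_def)
      then show ?case
        by (simp add: comb_mterm module_fscale hom.scale hom.m2.span_scale hom.m2.span_base)
    qed (simp_all add: comb.zero comb.add hom.add hom.m2.span_zero hom.m2.span_add)
    then show "(\<eta> \<circ> \<psi>) ` free_mod r' \<subseteq> degree_component smult Mg d"
      by (auto simp: free_mod_iff degree_component_def)
  next
    have "Mg d \<subseteq> (\<eta> \<circ> \<psi>) ` free_mod r'"
    proof
      fix m assume m: "m \<in> Mg d"
      obtain w where w: "w \<in> free_mod r" "\<eta> w = m" using surj by (metis UNIV_I imageE)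
      let ?S = "{a. tdeg D a = d}"
      have "\<eta> (hcomp D d w) = m"
        using graded_hom_hcomp[OF gh w(1)] w(2) m by simp
      moreover have "support (hcomp D d w) \<subseteq> terms r \<inter> ?S"
        using w(1) by (auto simp: support_hcomp free_mod_iff)
      ultimately obtain v where v: "support v \<subseteq> terms r \<inter> ?S \<inter> standard B" "\<eta> v = m"
        using normal_form[of ?S "hcomp D d w"] by (auto simp: below_def)
      obtain q where "\<psi> q = v" "support q \<subseteq> terms r'"
        using ex_preimage[OF v(1)] by (auto simp: tdeg_def)
      with v(2) show "m \<in> (\<eta> \<circ> \<psi>) ` free_mod r'"
        by (intro image_eqI[of _ _ q]) (auto simp: free_mod_iff)
    qed
    moreover have "hom.m2.subspace ((\<eta> \<circ> \<psi>) ` free_mod r')"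
    proof (rule comp.subspace_image)
      have keys_sub: "Poly_Mapping.keys (fscale p v) \<subseteq> Poly_Mapping.keys v"
        for p and v :: "('x, 'k) fvec"
        by (auto simp: in_keys_iff)
      show "hom.m1.subspace (free_mod r')"
      proof (rule hom.m1.subspaceI)
        show "v + w \<in> free_mod r'" if "v \<in> free_mod r'" "w \<in> free_mod r'"
          for v w :: "('x, 'k) fvec"
          using that keys_add[of v w] by (auto simp: free_mod_def)
        show "fscale p v \<in> free_mod r'" if "v \<in> free_mod r'" for p and v :: "('x, 'k) fvec"
          using that keys_sub[of p v] by (auto simp: free_mod_def)
      qed (simp add: free_mod_def)
    qed
    ultimately show "degree_component smult Mg d \<subseteq> (\<eta> \<circ> \<psi>) ` free_mod r'"
      unfolding degree_component_def by (rule hom.m2.span_minimal)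
  qed
qed

theorem corollary4:
  fixes smult :: "('x::finite, 'k::field) mpoly \<Rightarrow> 'm::ab_group_add \<Rightarrow> 'm"
    and Mg :: "int \<Rightarrow> 'm set"
  assumes "graded_module smult Mg"
    and "finitely_generated smult"
    and "initially_linear_syzygies smult Mg"
  shows "componentwise_linear smult Mg"
  unfolding componentwise_linear_def
proof
  fix d
  obtain r D \<eta> ord where pres: "graded_presentation smult Mg r D \<eta>" and "term_order r ord"
      "presentation_initially_linear r \<eta> ord"
    using assms(3) by (auto simp: initially_linear_syzygies_def)
  then obtain B where "linear_presentation smult \<eta> r D (ord - Id) B"
    using initially_linear_imp_linear_presentation[OF assms(1)] by blast
  then interpret linear_presentation smult \<eta> r D "ord - Id" B .
  obtain r' \<phi> where "truncation smult \<eta> r D (ord - Id) B d r' \<phi>"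
    using ex_truncation by blast
  then interpret truncation smult \<eta> r D "ord - Id" B d r' \<phi> .
  have "graded_hom fscale (free_graded r' D') smult Mg (\<eta> \<circ> \<psi>)"
    unfolding graded_hom_def
  proof (intro conjI allI)
    show "module_hom fscale smult (\<eta> \<circ> \<psi>)"
      by (rule module_hom_compose[OF comb.module_hom_axioms hom.module_hom_axioms])
    show "(\<eta> \<circ> \<psi>) ` free_graded r' D' e \<subseteq> Mg e" for e
      using comb_free_graded[of e] pres
      by (fastforce simp: graded_presentation_def graded_hom_def)
  qed
  then show "has_linear_resolution smult Mg (degree_component smult Mg d) d"
    using linear_presentation_imp_linear_resolution[OF truncated_presentation, of Mg d] D'_eq
      image_eq_degree_component[OF assms(1) pres] by simp
qed

end
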